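(* Let $\mathbb{K}$ be a field, let $G$ be a simple graph on $[n]$, let $S=\mathbb{K}[x_1,\ldots,x_n,y_1,\ldots,y_n]$ and $\mathfrak{m}=(x_1,\ldots,x_n,y_1,\ldots,y_n)$, and let $\mathcal{Q}_G$ be the poset of prime ideals of $S$ associated to the binomial edge ideal $J_G$ (defined in the context). Assume that $\mathfrak{m}\in\mathcal{Q}_G$. Then the poset $(\mathfrak{m},1_{\mathcal{Q}_G})$ is contractible.
   Context: All graphs are finite and simple, and $[n]=\{1,\ldots,n\}$. The binomial edge ideal of $G$ is $J_G=(x_iy_j-x_jy_i : \{i,j\}\in E(G),\ 1\leq i<j\leq n)\subseteq S$; for a graph on a subset of $[n]$ it is defined by the same formula. For a graph $G$ on $[n]$ and $T\subseteq[n]$, $G-T$ is the induced subgraph on $[n]\setminus T$, $c_G(T)$ is the number of its connected components $G_1,\ldots,G_{c_G(T)}$, $\widetilde{G}_j$ is the complete graph on $V(G_j)$, and $P_T(G)=(x_i,y_i : i\in T)+J_{\widetilde{G}_1}+\cdots+J_{\widetilde{G}_{c_G(T)}}$. $\mathcal{C}(G)$ is the set of all $T\subseteq[n]$ such that each $i\in T$ is a cut vertex of $G-(T\setminus\{i\})$ (a cut vertex is one whose removal increases the number of connected components); in particular $\emptyset\in\mathcal{C}(G)$. The minimal primary decomposition of $J_G$ is $J_G=\bigcap_{T\in\mathcal{C}(G)}P_T(G)$. For an ideal $I$ with a given (not necessarily minimal) decomposition $I=q_1\cap\cdots\cap q_t$, let $\mathcal{P}_I$ be the set of all sums of ideals from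 (nonempty subsets of) $\{q_1,\ldots,q_t\}$, ordered by reverse inclusion. Let $\mathcal{P}_G$ be this set for $J_G$ with its minimal primary decomposition. The poset $(\mathcal{Q}_G,\preccurlyeq)$, ordered by reverse inclusion ($p\preccurlyeq q$ iff $p\supseteq q$), consists of: the prime ideals in $\mathcal{P}_G$; the prime ideals in the sets $\mathcal{P}_I$, for each non-prime ideal $I\in\mathcal{P}_G$, where $\mathcal{P}_I$ is formed from the decomposition $I=q_1\cap\cdots\cap q_t\cap(q_1+P_\emptyset(G))\cap\cdots\cap(q_t+P_\emptyset(G))$ with $q_1,\ldots,q_t$ the minimal primes of $I$; and the prime ideals obtained by repeating this procedure every time a non-prime ideal is found. (That is, $\mathcal{Q}_G$ is the set of primes in the smallest family of ideals containing $\mathcal{P}_G$ and containing, for every non-prime member $I$ with minimal primes $q_1,\ldots,q_t$, the set $\mathcal{P}_I$ of all sums of ideals from nonempty subsets of $\{q_1,\ldots,q_t,q_1+P_\emptyset(G),\ldots,q_t+P_\emptyset(G)\}$.) A terminal (top) element $1_{\mathcal{Q}_G}$ is added to $\mathcal{Q}_G$, and for $q\in\mathcal{Q}_G$, $(q,1_{\mathcal{Q}_G})=\{z\in\mathcal{Q}_G : q\preccurlyeq z\preccurlyeq 1_{\mathcal{Q}_G},\ z\neq q,\ z\neq 1_{\mathcal{Q}_G}\}$, i.e. the elements $z\in\mathcal{Q}_G$ with $z\subsetneqq q$. The order complex of a poset is the simplicial complex whose facets are its maximal chains. A poset is contractible if its order complex is contractible. *)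

theory Defs
  imports "HOL-Analysis.Analysis" "HOL-Algebra.Algebra" "HOL-Library.Poly_Mapping"
begin

section \<open>Finite simple graphs\<close>

text \<open>A graph is a pair of a vertex set and a set of edges, each edge being a two-element set of
  vertices.\<close>

type_synonym graph = "nat set \<times> nat set set"

abbreviation gverts :: "graph \<Rightarrow> nat set" where "gverts G \<equiv> fst G"
abbreviation gedges :: "graph \<Rightarrow> nat set set" where "gedges G \<equiv> snd G"

definition simple_graph :: "graph \<Rightarrow> bool" where
  "simple_graph G \<longleftrightarrow> finite (gverts G) \<and> (\<forall>e\<in>gedges G. e \<subseteq> gverts G \<and> card e = 2)"

definition delete_verts :: "graph \<Rightarrow> nat set \<Rightarrow> graph" where
  "delete_verts G T = (gverts G - T, {e \<in> gedges G. e \<subseteq> gverts G - T})"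

definition connected_rel :: "graph \<Rightarrow> (nat \<times> nat) set" where
  "connected_rel G =
     {(u, v). u \<in> gverts G \<and> v \<in> gverts G \<and> (u, v) \<in> {(a, b). {a, b} \<in> gedges G}\<^sup>*}"

definition components :: "graph \<Rightarrow> nat set set" where
  "components G = gverts G // connected_rel G"

definition cut_vertex :: "graph \<Rightarrow> nat \<Rightarrow> bool" where
  "cut_vertex G v \<longleftrightarrow>
     v \<in> gverts G \<and> card (components G) < card (components (delete_verts G {v}))"

definition complete_graph :: "nat set \<Rightarrow> graph" where
  "complete_graph C = (C, {{i, j} | i j. i \<in> C \<and> j \<in> C \<and> i \<noteq> j})"

definition cut_sets :: "graph \<Rightarrow> nat set set" where
  "cut_sets G =
     {T. T \<subseteq> gverts G \<and> (\<forall>i\<in>T. cut_vertex (delete_verts G (T - {i})) i)}"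


section \<open>The polynomial ring\<close>

text \<open>A monomial is a finitely supported exponent function on the variables, and a polynomial a
  finitely supported coefficient function on the monomials; multiplication on \<^typ>\<open>'a \<Rightarrow>\<^sub>0 'b\<close>
  is convolution. The type admits all the variables \<open>x\<^sub>i\<close>, \<open>y\<^sub>i\<close> with \<open>i :: nat\<close>, so the ring
  \<open>K[x\<^sub>1, \<dots>, x\<^sub>n, y\<^sub>1, \<dots>, y\<^sub>n]\<close> is cut out by its carrier.\<close>

datatype xyvar = Xvar nat | Yvar nat

type_synonym 'k xypoly = "(xyvar \<Rightarrow>\<^sub>0 nat) \<Rightarrow>\<^sub>0 'k"

definition poly_var :: "xyvar \<Rightarrow> 'k::field xypoly" where
  "poly_var v = Poly_Mapping.single (Poly_Mapping.single v 1) 1"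

abbreviation xv :: "nat \<Rightarrow> 'k::field xypoly" where "xv i \<equiv> poly_var (Xvar i)"
abbreviation yv :: "nat \<Rightarrow> 'k::field xypoly" where "yv i \<equiv> poly_var (Yvar i)"

definition poly_carrier :: "nat \<Rightarrow> 'k::field xypoly set" where
  "poly_carrier n =
     {p. \<forall>t\<in>Poly_Mapping.keys p. Poly_Mapping.keys t \<subseteq> Xvar ` {1..n} \<union> Yvar ` {1..n}}"

definition poly_ring :: "nat \<Rightarrow> 'k::field xypoly ring" where
  "poly_ring n =
     \<lparr>carrier = poly_carrier n, mult = (*), one = 1, ring.zero = 0, add = (+)\<rparr>"

lemma poly_carrier_add: "p \<in> poly_carrier n \<Longrightarrow> q \<in> poly_carrier n \<Longrightarrow> p + q \<in> poly_carrier n"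
  unfolding poly_carrier_def using Poly_Mapping.keys_add[of p q] by blast

lemma poly_carrier_uminus: "p \<in> poly_carrier n \<Longrightarrow> - p \<in> poly_carrier n"
  by (simp add: poly_carrier_def)

lemma poly_carrier_mult:
  assumes "p \<in> poly_carrier n" and "q \<in> poly_carrier n"
  shows "p * q \<in> poly_carrier n"
proof -
  have "Poly_Mapping.keys t \<subseteq> Xvar ` {1..n} \<union> Yvar ` {1..n}"
    if t: "t \<in> Poly_Mapping.keys (p * q)" for t
  proof -
    obtain a b where ab: "t = a + b" "a \<in> Poly_Mapping.keys p" "b \<in> Poly_Mapping.keys q"
      using t keys_mult[of p q] by blast
    have "Poly_Mapping.keys t \<subseteq> Poly_Mapping.keys a \<union> Poly_Mapping.keys b"
      unfolding ab by (rule Poly_Mapping.keys_add)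
    then show ?thesis
      using assms ab unfolding poly_carrier_def by blast
  qed
  then show ?thesis
    by (simp add: poly_carrier_def)
qed

lemma poly_carrier_zero: "0 \<in> poly_carrier n"
  by (simp add: poly_carrier_def)

lemma poly_carrier_one: "1 \<in> poly_carrier n"
  by (simp add: poly_carrier_def)

lemma cring_poly_ring: "cring (poly_ring n :: 'k::field xypoly ring)"
proof (rule cringI)
  show "abelian_group (poly_ring n :: 'k xypoly ring)"
  proof (rule abelian_groupI)
    fix p :: "'k xypoly"
    assume "p \<in> carrier (poly_ring n)"
    then show "\<exists>q\<in>carrier (poly_ring n). q \<oplus>\<^bsub>poly_ring n\<^esub> p = \<zero>\<^bsub>poly_ring n\<^esub>"
      by (intro bexI[of _ "- p"]) (auto simp: poly_ring_def poly_carrier_uminus)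
  qed (auto simp: poly_ring_def poly_carrier_add poly_carrier_zero algebra_simps)
  show "comm_monoid (poly_ring n :: 'k xypoly ring)"
    by (rule comm_monoidI)
      (auto simp: poly_ring_def poly_carrier_mult poly_carrier_one algebra_simps)
qed (auto simp: poly_ring_def algebra_simps)


section \<open>Ideals associated with a graph\<close>

definition ideal_Sum :: "('a, 'b) ring_scheme \<Rightarrow> 'a set set \<Rightarrow> 'a set" where
  "ideal_Sum R A = Idl\<^bsub>R\<^esub> (\<Union>A)"

definition minimal_primes :: "('a, 'b) ring_scheme \<Rightarrow> 'a set \<Rightarrow> 'a set set" where
  "minimal_primes R I =
     {q. primeideal q R \<and> I \<subseteq> q \<and> \<not> (\<exists>p. primeideal p R \<and> I \<subseteq> p \<and> p \<subset> q)}"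

definition irrelevant_ideal :: "nat \<Rightarrow> 'k::field xypoly set" where
  "irrelevant_ideal n = Idl\<^bsub>poly_ring n\<^esub> (xv ` {1..n} \<union> yv ` {1..n})"

definition binomial_edge_ideal :: "nat \<Rightarrow> graph \<Rightarrow> 'k::field xypoly set" where
  "binomial_edge_ideal n G = Idl\<^bsub>poly_ring n\<^esub>
     {xv i * yv j - xv j * yv i | i j. {i, j} \<in> gedges G \<and> 1 \<le> i \<and> i < j \<and> j \<le> n}"

definition P_ideal :: "nat \<Rightarrow> graph \<Rightarrow> nat set \<Rightarrow> 'k::field xypoly set" where
  "P_ideal n G T = ideal_Sum (poly_ring n)
     (insert (Idl\<^bsub>poly_ring n\<^esub> (xv ` T \<union> yv ` T))
       ((\<lambda>C. binomial_edge_ideal n (complete_graph C)) ` components (delete_verts G T)))"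

definition ideal_sums :: "('a, 'b) ring_scheme \<Rightarrow> 'a set set \<Rightarrow> 'a set set" where
  "ideal_sums R D = {ideal_Sum R A | A. A \<subseteq> D \<and> A \<noteq> {}}"

text \<open>Sums formed from the decomposition of \<^term>\<open>binomial_edge_ideal n G\<close> into the
  \<^term>\<open>P_ideal n G T\<close> with \<^term>\<open>T \<in> cut_sets G\<close>, which is its minimal primary decomposition.\<close>

definition P_sums :: "nat \<Rightarrow> graph \<Rightarrow> 'k::field xypoly set set" where
  "P_sums n G = ideal_sums (poly_ring n) (P_ideal n G ` cut_sets G)"

inductive_set Q_family :: "nat \<Rightarrow> graph \<Rightarrow> 'k::field xypoly set set"
  for n :: nat and G :: graph where
  base: "I \<in> P_sums n G \<Longrightarrow> I \<in> Q_family n G"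
| step: "\<lbrakk>I \<in> Q_family n G; \<not> primeideal I (poly_ring n);
          J \<in> ideal_sums (poly_ring n)
                (minimal_primes (poly_ring n) I \<union>
                 (\<lambda>q. q <+>\<^bsub>poly_ring n\<^esub> P_ideal n G {}) ` minimal_primes (poly_ring n) I)\<rbrakk>
         \<Longrightarrow> J \<in> Q_family n G"

definition Q_poset :: "nat \<Rightarrow> graph \<Rightarrow> 'k::field xypoly set set" where
  "Q_poset n G = {I \<in> Q_family n G. primeideal I (poly_ring n)}"

text \<open>The order on \<^const>\<open>Q_poset\<close> is reverse inclusion, so the open interval from \<open>q\<close> to the
  added top element consists of the members properly contained in \<open>q\<close>.\<close>

definition Q_interval_top :: "nat \<Rightarrow> graph \<Rightarrow> 'k::field xypoly set \<Rightarrow> 'k xypoly set set" where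
  "Q_interval_top n G q = {z \<in> Q_poset n G. z \<subset> q}"


section \<open>Order complexes and contractibility\<close>

text \<open>A poset is given by a carrier \<open>P\<close> and a strict order \<open>lt\<close>; abstract simplicial complexes are
  represented by their sets of nonempty faces.\<close>

definition order_complex :: "'a set \<Rightarrow> ('a \<Rightarrow> 'a \<Rightarrow> bool) \<Rightarrow> 'a set set" where
  "order_complex P lt =
     {\<sigma>. finite \<sigma> \<and> \<sigma> \<noteq> {} \<and> (\<exists>C. pred_on.maxchain P lt C \<and> \<sigma> \<subseteq> C)}"

text \<open>Points of the geometric realization are given by barycentric coordinates.\<close>

definition realization_points :: "'a set set \<Rightarrow> ('a \<Rightarrow> real) set" where
  "realization_points K =
     {f. (\<forall>v. 0 \<le> f v) \<and> {v. f v \<noteq> 0} \<in> K \<and> (\<Sum>v | f v \<noteq> 0. f v) = 1}"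

definition closed_simplex :: "'a set \<Rightarrow> ('a \<Rightarrow> real) set" where
  "closed_simplex \<sigma> = {f. (\<forall>v. 0 \<le> f v) \<and> {v. f v \<noteq> 0} \<subseteq> \<sigma> \<and> (\<Sum>v\<in>\<sigma>. f v) = 1}"

text \<open>The realization carries the weak topology determined by its closed simplices, each of which
  has its Euclidean topology (as a subspace of a power of the real line).\<close>

definition realization :: "'a set set \<Rightarrow> ('a \<Rightarrow> real) topology" where
  "realization K = topology (\<lambda>U. U \<subseteq> realization_points K \<and>
     (\<forall>\<sigma>\<in>K. openin (top_of_set (closed_simplex \<sigma>)) (U \<inter> closed_simplex \<sigma>)))"

lemma openin_realization:
  "openin (realization K) U \<longleftrightarrow> U \<subseteq> realization_points K \<and>
     (\<forall>\<sigma>\<in>K. openin (top_of_set (closed_simplex \<sigma>)) (U \<inter> closed_simplex \<sigma>))"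
proof -
  have "istopology (\<lambda>U. U \<subseteq> realization_points K \<and>
     (\<forall>\<sigma>\<in>K. openin (top_of_set (closed_simplex \<sigma>)) (U \<inter> closed_simplex \<sigma>)))"
    unfolding istopology_def
  proof (intro conjI allI impI ballI; (elim conjE)?)
    fix S T \<sigma>
    assume "\<sigma> \<in> K"
      and "\<forall>\<sigma>\<in>K. openin (top_of_set (closed_simplex \<sigma>)) (S \<inter> closed_simplex \<sigma>)"
      and "\<forall>\<sigma>\<in>K. openin (top_of_set (closed_simplex \<sigma>)) (T \<inter> closed_simplex \<sigma>)"
    then have "openin (top_of_set (closed_simplex \<sigma>))
        ((S \<inter> closed_simplex \<sigma>) \<inter> (T \<inter> closed_simplex \<sigma>))"
      by (blast intro: openin_Int)
    moreover have "(S \<inter> closed_simplex \<sigma>) \<inter> (T \<inter> closed_simplex \<sigma>) = S \<inter> T \<inter> closed_simplex \<sigma>"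
      by blast
    ultimately show "openin (top_of_set (closed_simplex \<sigma>)) (S \<inter> T \<inter> closed_simplex \<sigma>)"
      by (simp only:)
  next
    fix \<K> \<sigma>
    assume "\<sigma> \<in> K" and "\<forall>U\<in>\<K>. U \<subseteq> realization_points K \<and>
      (\<forall>\<sigma>\<in>K. openin (top_of_set (closed_simplex \<sigma>)) (U \<inter> closed_simplex \<sigma>))"
    then have "openin (top_of_set (closed_simplex \<sigma>)) (\<Union>U\<in>\<K>. U \<inter> closed_simplex \<sigma>)"
      by (blast intro: openin_Union)
    moreover have "(\<Union>U\<in>\<K>. U \<inter> closed_simplex \<sigma>) = \<Union>\<K> \<inter> closed_simplex \<sigma>"
      by blast
    ultimately show "openin (top_of_set (closed_simplex \<sigma>)) (\<Union>\<K> \<inter> closed_simplex \<sigma>)"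
      by (simp only:)
  qed auto
  then show ?thesis
    by (simp add: realization_def topology_inverse')
qed

text \<open>In the library the empty space counts as contractible, contrary to the usual convention;
  hence the separate nonemptiness condition.\<close>

definition contractible_poset :: "'a set \<Rightarrow> ('a \<Rightarrow> 'a \<Rightarrow> bool) \<Rightarrow> bool" where
  "contractible_poset P lt \<longleftrightarrow>
     topspace (realization (order_complex P lt)) \<noteq> {} \<and>
     contractible_space (realization (order_complex P lt))"

end

theory Submission
  imports Defs
begin

text \<open>
  Let \<open>P\<close> be the ideal \<^term>\<open>P_ideal n G {}\<close>, that is, the ideal of all the 2-minors
  \<open>x\<^sub>i y\<^sub>j - x\<^sub>j y\<^sub>i\<close> with \<open>i\<close> and \<open>j\<close> in one component of \<open>G\<close>. The interval below the
  irrelevant ideal is contractible because \<open>q \<mapsto> q + P\<close> is a closure operator on it: for every \<open>q\<close> in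
  the interval, \<open>q + P\<close> is again in the interval and is the least member containing \<open>q\<close> and \<open>P\<close>.
  A poset in which every element has a join with one fixed element is conically contractible
  (\<open>q \<le> q + P \<ge> P\<close>); since the interval is finite, this can be made explicit by deleting
  the points outside the cone above \<open>P\<close> one at a time (\<open>contractible_poset_joins\<close>).

  Two things have to be checked. First, \<open>q + P\<close> lies in the family generated by the \<open>P_ideal\<close>s.
  This is a formal consequence of \<open>q + P\<close> being among the summands that the construction offers
  at every step, and of \<open>(q + P) + P = q + P\<close> (\<open>Q_family_add_P_ideal\<close>). Secondly,
  \<open>q + P\<close> is prime and differs from the irrelevant ideal. For this, every member of the family is
  shown to be generated by the variables \<open>x\<^sub>i, y\<^sub>i\<close> with \<open>i\<close> in a set \<open>T\<close> and by the minors
  belonging to a set \<open>E\<close> of pairs, each pair inside a component of \<open>G\<close> (\<open>Q_family_subset\<close>).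
  Adding \<open>P\<close> then replaces \<open>E\<close> by the whole relation of being in one component.
  Such an ideal is prime because it is the kernel of a map to a domain that sends monomials to
  monomials or to zero (\<open>var_minor_ideal_label_pairs\<close>), and it is irrelevant only if \<open>T\<close> is the set
  of all the vertices, in which case \<open>q\<close> itself is irrelevant.

  Sums of ideals of this shape obviously have this shape. So do their minimal primes, because any
  prime \<open>p\<close> over such an ideal contains a prime of this shape over the same ideal, namely the one
  given by the vertices \<open>i\<close> with \<open>x\<^sub>i, y\<^sub>i \<in> p\<close> and by the minors in \<open>p\<close> that belong to pairs
  inside the components of \<open>G\<close> (\<open>prime_contains_var_minor_prime\<close>).
\<close>

section \<open>Finite posets with joins are contractible\<close>

definition finite_chains :: "'a::order set \<Rightarrow> 'a set set" where
  "finite_chains P = {\<sigma>. \<sigma> \<subseteq> P \<and> finite \<sigma> \<and> \<sigma> \<noteq> {} \<and> (\<forall>a\<in>\<sigma>. \<forall>b\<in>\<sigma>. a \<le> b \<or> b \<le> a)}"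

text \<open>In a finite poset every chain extends to a maximal one, namely to a chain that is
  inclusion-maximal among the finitely many chains.\<close>

lemma order_complex_eq_finite_chains:
  fixes P :: "'a::order set"
  assumes "finite P"
  shows "order_complex P (\<lambda>p q. q < p) = finite_chains P"
proof -
  interpret pred_on P "\<lambda>p q. q < p" .
  have chain_iff: "chain C \<longleftrightarrow> C \<subseteq> P \<and> (\<forall>a\<in>C. \<forall>b\<in>C. a \<le> b \<or> b \<le> a)" for C
    unfolding chain_def by (auto simp: order.order_iff_strict)
  have "\<exists>C. maxchain C \<and> \<sigma> \<subseteq> C" if "chain \<sigma>" for \<sigma>
  proof -
    have "finite {C. chain C}"
      by (rule finite_subset[of _ "Pow P"]) (use assms in \<open>auto simp: chain_iff\<close>)
    then obtain M where "M \<in> {C. chain C}" "\<sigma> \<subseteq> M" "\<forall>C\<in>{C. chain C}. M \<subseteq> C \<longrightarrow> C = M"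
      using finite_has_maximal2[of "{C. chain C}" \<sigma>] \<open>chain \<sigma>\<close> by (metis mem_Collect_eq)
    then show ?thesis
      unfolding maxchain_def by (metis (mono_tags) mem_Collect_eq psubset_eq)
  qed
  moreover have "chain \<sigma>" if "maxchain C" "\<sigma> \<subseteq> C" for C \<sigma>
    using that maxchain_imp_chain[of C] unfolding chain_iff by blast
  ultimately have "(\<exists>C. maxchain C \<and> \<sigma> \<subseteq> C) \<longleftrightarrow> chain \<sigma>" for \<sigma>
    by metis
  then show ?thesis
    unfolding order_complex_def finite_chains_def by (auto simp: chain_iff)
qed

lemma realization_points_eq_Union:
  assumes K: "\<And>\<sigma>. \<sigma> \<in> K \<Longrightarrow> finite \<sigma>" "\<And>\<sigma> \<tau>. \<sigma> \<in> K \<Longrightarrow> \<tau> \<subseteq> \<sigma> \<Longrightarrow> \<tau> \<noteq> {} \<Longrightarrow> \<tau> \<in> K"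
  shows "realization_points K = (\<Union>\<sigma>\<in>K. closed_simplex \<sigma>)"
proof (intro equalityI subsetI)
  fix f assume "f \<in> realization_points K"
  then have "{v. f v \<noteq> 0} \<in> K" "f \<in> closed_simplex {v. f v \<noteq> 0}"
    by (auto simp: realization_points_def closed_simplex_def)
  then show "f \<in> (\<Union>\<sigma>\<in>K. closed_simplex \<sigma>)" by blast
next
  fix f assume "f \<in> (\<Union>\<sigma>\<in>K. closed_simplex \<sigma>)"
  then obtain \<sigma> where \<sigma>: "\<sigma> \<in> K" and f: "\<forall>v. 0 \<le> f v" "{v. f v \<noteq> 0} \<subseteq> \<sigma>" "sum f \<sigma> = 1"
    by (auto simp: closed_simplex_def)
  have "sum f {v. f v \<noteq> 0} = sum f \<sigma>"
    by (rule sum.mono_neutral_left) (use K(1)[OF \<sigma>] f in auto)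
  moreover from this have "{v. f v \<noteq> 0} \<noteq> {}"
    using f(3) by (metis sum.empty zero_neq_one)
  then have "{v. f v \<noteq> 0} \<in> K"
    using K(2) \<sigma> f(2) by blast
  ultimately show "f \<in> realization_points K"
    using f by (simp add: realization_points_def)
qed

lemma closed_closed_simplex:
  assumes "finite \<sigma>"
  shows "closed (closed_simplex \<sigma> :: ('a \<Rightarrow> real) set)"
proof -
  have "closed_simplex \<sigma> = (\<Inter>v. {f::'a \<Rightarrow> real. 0 \<le> f v}) \<inter> (\<Inter>v\<in>-\<sigma>. {f. f v = 0})
      \<inter> {f. (\<Sum>v\<in>\<sigma>. f v) = 1}"
    by (auto simp: closed_simplex_def)
  moreover have "continuous_on UNIV (\<lambda>f::'a \<Rightarrow> real. f v)" for v
    by (rule continuous_on_product_coordinates)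
  ultimately show ?thesis
    by (auto intro!: closed_Int closed_INT closed_Collect_le closed_Collect_eq continuous_intros)
qed

text \<open>A finite complex is a finite union of closed simplices, each of them closed in the product
  topology. So a set is relatively closed as soon as its trace on every simplex is closed, and the weak
  topology is the one of pointwise convergence. This makes continuity a matter of coordinates,
  also on products with the unit interval.\<close>

lemma realization_eq_subspace:
  fixes K :: "'a set set"
  assumes "finite K" and K: "\<And>\<sigma>. \<sigma> \<in> K \<Longrightarrow> finite \<sigma>"
    "\<And>\<sigma> \<tau>. \<sigma> \<in> K \<Longrightarrow> \<tau> \<subseteq> \<sigma> \<Longrightarrow> \<tau> \<noteq> {} \<Longrightarrow> \<tau> \<in> K"
  shows "realization K = top_of_set (realization_points K)"
proof (rule topology_eq[THEN iffD2], intro allI iffI)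
  let ?X = "realization_points K"
  have X: "?X = (\<Union>\<sigma>\<in>K. closed_simplex \<sigma>)"
    by (rule realization_points_eq_Union) (use K in auto)
  fix U :: "('a \<Rightarrow> real) set"
  {
    assume U: "openin (realization K) U"
    have "closed (closed_simplex \<sigma> - U)" if "\<sigma> \<in> K" for \<sigma>
    proof -
      have "openin (top_of_set (closed_simplex \<sigma>)) (U \<inter> closed_simplex \<sigma>)"
        using U that by (simp add: openin_realization)
      then have "closedin (top_of_set (closed_simplex \<sigma>)) (closed_simplex \<sigma> - U \<inter> closed_simplex \<sigma>)"
        by (simp add: closedin_diff)
      moreover have "closed_simplex \<sigma> - U \<inter> closed_simplex \<sigma> = closed_simplex \<sigma> - U" by blast
      ultimately show ?thesis
        using closed_closed_simplex[OF K(1)[OF that]] closedin_closed_trans by metis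
    qed
    then have "closed (\<Union>\<sigma>\<in>K. closed_simplex \<sigma> - U)"
      using \<open>finite K\<close> by blast
    moreover have "U = ?X \<inter> - (\<Union>\<sigma>\<in>K. closed_simplex \<sigma> - U)"
      using U unfolding openin_realization X by blast
    ultimately show "openin (top_of_set ?X) U"
      by (metis openin_open open_Compl)
  next
    assume "openin (top_of_set ?X) U"
    then obtain V where "open V" "U = ?X \<inter> V"
      by (auto simp: openin_open)
    moreover from this have "U \<inter> closed_simplex \<sigma> = closed_simplex \<sigma> \<inter> V" if "\<sigma> \<in> K" for \<sigma>
      using X that by blast
    ultimately show "openin (realization K) U"
      unfolding openin_realization by (auto simp: openin_open)
  }
qed

abbreviation chain_space :: "'a::order set \<Rightarrow> ('a \<Rightarrow> real) set" where
  "chain_space P \<equiv> realization_points (finite_chains P)"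

lemma chain_space_eq_Union: "chain_space P = (\<Union>\<sigma>\<in>finite_chains P. closed_simplex \<sigma>)"
  by (rule realization_points_eq_Union) (auto simp: finite_chains_def intro: finite_subset)

lemma realization_order_complex:
  fixes P :: "'a::order set"
  assumes "finite P"
  shows "realization (order_complex P (\<lambda>p q. q < p)) = top_of_set (chain_space P)"
  unfolding order_complex_eq_finite_chains[OF assms]
proof (rule realization_eq_subspace)
  show "finite (finite_chains P)"
    by (rule finite_subset[of _ "Pow P"]) (use assms in \<open>auto simp: finite_chains_def\<close>)
qed (auto simp: finite_chains_def intro: finite_subset)

lemma closed_simplex_convex_combination:
  assumes "f \<in> closed_simplex \<sigma>" "g \<in> closed_simplex \<sigma>" "0 \<le> t" "t \<le> (1::real)"
  shows "(\<lambda>v. (1 - t) * f v + t * g v) \<in> closed_simplex \<sigma>"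
proof -
  have "(\<Sum>v\<in>\<sigma>. (1 - t) * f v + t * g v) = (1 - t) * sum f \<sigma> + t * sum g \<sigma>"
    by (simp add: sum.distrib sum_distrib_left)
  moreover have "{v. (1 - t) * f v + t * g v \<noteq> 0} \<subseteq> {v. f v \<noteq> 0} \<union> {v. g v \<noteq> 0}"
    by auto
  then have "{v. (1 - t) * f v + t * g v \<noteq> 0} \<subseteq> \<sigma>"
    using assms(1,2) unfolding closed_simplex_def by blast
  ultimately show ?thesis
    using assms unfolding closed_simplex_def by simp
qed

text \<open>The straight line from \<open>f\<close> to \<open>g f\<close> stays in the complex when both ends lie in a
  common simplex.\<close>

lemma homotopic_straight_line:
  assumes "continuous_on (chain_space P) g"
    and g: "\<And>f. f \<in> chain_space P \<Longrightarrow> \<exists>\<sigma>\<in>finite_chains P. f \<in> closed_simplex \<sigma> \<and> g f \<in> closed_simplex \<sigma>"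
  shows "homotopic_with (\<lambda>_. True) (top_of_set (chain_space P)) (top_of_set (chain_space P)) id g"
  unfolding homotopic_with_def
proof (intro exI conjI ballI allI)
  let ?X = "chain_space P"
  let ?h = "\<lambda>(t::real, f). (\<lambda>v. (1 - t) * f v + t * g f v)"
  have g': "continuous_on ?X (\<lambda>f. g f v)" for v
    by (rule continuous_on_product_then_coordinatewise[OF assms(1)])
  have "continuous_on ({0..1} \<times> ?X) ?h"
    unfolding case_prod_unfold
  proof (rule continuous_on_coordinatewise_then_product)
    fix v
    have "continuous_on ({0..1} \<times> ?X) (\<lambda>p. snd p v)"
      by (rule continuous_on_compose2[OF continuous_on_product_coordinates])
        (auto intro: continuous_intros)
    moreover have "continuous_on ({0..1} \<times> ?X) (\<lambda>p. g (snd p) v)"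
      by (rule continuous_on_compose2[OF g'[of v]]) (auto intro: continuous_intros)
    ultimately show "continuous_on ({0..1} \<times> ?X) (\<lambda>p. (1 - fst p) * snd p v + fst p * g (snd p) v)"
      by (intro continuous_intros)
  qed
  moreover have "?h ` ({0..1} \<times> ?X) \<subseteq> ?X"
  proof clarsimp
    fix t :: real and f assume t: "0 \<le> t" "t \<le> 1" and f: "f \<in> ?X"
    obtain \<sigma> where "\<sigma> \<in> finite_chains P" "f \<in> closed_simplex \<sigma>" "g f \<in> closed_simplex \<sigma>"
      using g[OF f] by blast
    then show "(\<lambda>v. (1 - t) * f v + t * g f v) \<in> ?X"
      unfolding chain_space_eq_Union using closed_simplex_convex_combination[OF _ _ t] by blast
  qed
  ultimately show "continuous_map (prod_topology (top_of_set {0..1}) (top_of_set ?X)) (top_of_set ?X) ?h"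
    by (simp add: subtopology_Times[symmetric] continuous_map_in_subtopology image_subset_iff_funcset)
qed auto

lemma chain_space_coordinates_continuous: "continuous_on S (\<lambda>f. f v :: real)"
  by (rule continuous_on_subset[OF continuous_on_product_coordinates]) auto

lemma contractible_cone:
  fixes P :: "'a::order set"
  assumes c: "c \<in> P" "\<And>z. z \<in> P \<Longrightarrow> c \<le> z"
  shows "contractible_space (top_of_set (chain_space P))"
  unfolding contractible_space_def
proof (intro exI)
  show "homotopic_with (\<lambda>_. True) (top_of_set (chain_space P)) (top_of_set (chain_space P)) id
      (\<lambda>_. indicat_real {c})"
  proof (rule homotopic_straight_line)
    fix f assume "f \<in> chain_space P"
    then obtain \<sigma> where \<sigma>: "\<sigma> \<in> finite_chains P" "f \<in> closed_simplex \<sigma>"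
      unfolding chain_space_eq_Union by blast
    then have fin: "finite \<sigma>" by (simp add: finite_chains_def)
    have "insert c \<sigma> \<in> finite_chains P"
      using \<sigma>(1) c unfolding finite_chains_def by auto
    moreover have "sum f (insert c \<sigma>) = sum f \<sigma>"
      by (rule sum.mono_neutral_right) (use \<sigma> fin in \<open>auto simp: closed_simplex_def\<close>)
    then have "f \<in> closed_simplex (insert c \<sigma>)"
      using \<sigma>(2) by (auto simp: closed_simplex_def)
    moreover have "sum (indicat_real {c}) (insert c \<sigma>) = 1"
      using fin by (simp add: indicator_def)
    then have "indicat_real {c} \<in> closed_simplex (insert c \<sigma>)"
      by (auto simp: closed_simplex_def indicator_def)
    ultimately show "\<exists>\<tau>\<in>finite_chains P. f \<in> closed_simplex \<tau> \<and> indicat_real {c} \<in> closed_simplex \<tau>"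
      by blast
  qed (rule continuous_on_const)
qed

text \<open>The simplicial retraction that sends the vertex \<open>x\<close> to \<open>y\<close>, in barycentric coordinates.\<close>

definition push_mass :: "'a \<Rightarrow> 'a \<Rightarrow> ('a \<Rightarrow> real) \<Rightarrow> 'a \<Rightarrow> real" where
  "push_mass x y f = (\<lambda>v. if v = x then 0 else if v = y then f y + f x else f v)"

lemma push_mass_closed_simplex:
  assumes "f \<in> closed_simplex \<sigma>" "finite \<sigma>" "x \<noteq> y"
  shows "push_mass x y f \<in> closed_simplex (insert y \<sigma> - {x})"
proof -
  have "sum (push_mass x y f) (insert y \<sigma> - {x}) = (f y + f x) + sum f (\<sigma> - {x, y})"
  proof -
    have "insert y \<sigma> - {x} = insert y (\<sigma> - {x, y})" using assms(3) by auto
    moreover have "sum (push_mass x y f) (\<sigma> - {x, y}) = sum f (\<sigma> - {x, y})"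
      by (rule sum.cong) (auto simp: push_mass_def)
    ultimately show ?thesis
      using assms(2,3) by (simp add: push_mass_def)
  qed
  also have "\<dots> = sum f (insert x (insert y (\<sigma> - {x, y})))"
    using assms(2,3) by simp
  also have "\<dots> = sum f \<sigma>"
    by (rule sum.mono_neutral_right) (use assms in \<open>auto simp: closed_simplex_def\<close>)
  finally show ?thesis
    using assms by (auto simp: closed_simplex_def push_mass_def split: if_splits)
qed

text \<open>If everything comparable to \<open>x\<close> is comparable to \<open>y\<close>, a chain through \<open>x\<close> remains a chain
  after \<open>y\<close> is added. Pushing the mass at \<open>x\<close> to \<open>y\<close> is thus homotopic to the identity, and
  the identity of the complex factors, up to homotopy, through the contractible one without \<open>x\<close>.\<close>

lemma contractible_remove_beat_point:
  fixes P :: "'a::order set"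
  assumes "y \<in> P" "x \<noteq> y"
    and beat: "\<And>z. z \<in> P \<Longrightarrow> z \<le> x \<or> x \<le> z \<Longrightarrow> z \<le> y \<or> y \<le> z"
    and contr: "contractible_space (top_of_set (chain_space (P - {x})))"
  shows "contractible_space (top_of_set (chain_space P))"
proof -
  let ?X = "chain_space P" and ?Y = "chain_space (P - {x})"
  have carrier: "\<exists>\<sigma>\<in>finite_chains P. f \<in> closed_simplex \<sigma> \<and> push_mass x y f \<in> closed_simplex \<sigma>
     \<and> push_mass x y f \<in> ?Y" if "f \<in> ?X" for f
  proof -
    have supp: "{v. f v \<noteq> 0} \<in> finite_chains P" "f \<in> closed_simplex {v. f v \<noteq> 0}"
      using that by (auto simp: realization_points_def closed_simplex_def)
    show ?thesis
    proof (cases "f x = 0")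
      case True
      then have "push_mass x y f = f"
        by (auto simp: push_mass_def)
      moreover have "{v. f v \<noteq> 0} \<in> finite_chains (P - {x})"
        using supp(1) True by (auto simp: finite_chains_def)
      ultimately show ?thesis
        using supp unfolding chain_space_eq_Union[of "P - {x}"] by auto
    next
      case False
      define \<sigma> where "\<sigma> = {v. f v \<noteq> 0}"
      have \<sigma>: "\<sigma> \<in> finite_chains P" "f \<in> closed_simplex \<sigma>" "x \<in> \<sigma>" "finite \<sigma>"
        using supp False by (auto simp: \<sigma>_def finite_chains_def)
      have "z \<le> y \<or> y \<le> z" if "z \<in> \<sigma>" for z
        using that beat[of z] \<sigma>(1,3) by (auto simp: finite_chains_def)
      then have ins: "insert y \<sigma> \<in> finite_chains P"
        using \<sigma>(1) \<open>y \<in> P\<close> by (auto simp: finite_chains_def)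
      then have del: "insert y \<sigma> - {x} \<in> finite_chains (P - {x})"
        using \<open>x \<noteq> y\<close> by (auto simp: finite_chains_def)
      have push: "push_mass x y f \<in> closed_simplex (insert y \<sigma> - {x})"
        by (rule push_mass_closed_simplex) (use \<sigma> \<open>x \<noteq> y\<close> in auto)
      have mono: "g \<in> closed_simplex \<tau>'"
        if "g \<in> closed_simplex \<tau>" "\<tau> \<subseteq> \<tau>'" "finite \<tau>'" for g :: "'a \<Rightarrow> real" and \<tau> \<tau>'
      proof -
        have "sum g \<tau>' = sum g \<tau>"
          by (rule sum.mono_neutral_right) (use that in \<open>auto simp: closed_simplex_def\<close>)
        then show ?thesis using that by (auto simp: closed_simplex_def)
      qed
      have "f \<in> closed_simplex (insert y \<sigma>)" "push_mass x y f \<in> closed_simplex (insert y \<sigma>)"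
        using mono[OF \<sigma>(2)] mono[OF push] \<sigma>(4) by auto
      then show ?thesis
        using ins del push unfolding chain_space_eq_Union[of "P - {x}"] by blast
    qed
  qed
  have cont: "continuous_on ?X (push_mass x y)"
    unfolding push_mass_def
  proof (rule continuous_on_coordinatewise_then_product)
    fix v
    show "continuous_on ?X (\<lambda>f. if v = x then 0 else if v = y then f y + f x else f v)"
      by (cases "v = x"; cases "v = y")
        (auto intro!: continuous_intros chain_space_coordinates_continuous)
  qed
  have "continuous_map (top_of_set ?X) (top_of_set ?Y) (push_mass x y)"
    using cont carrier by (auto simp: continuous_map_in_subtopology)
  moreover have "?Y \<subseteq> ?X"
    by (auto simp: realization_points_def finite_chains_def)
  then have "continuous_map (top_of_set ?Y) (top_of_set ?X) id"
    by (auto simp: continuous_map_in_subtopology)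
  ultimately obtain k where
    "homotopic_with (\<lambda>_. True) (top_of_set ?X) (top_of_set ?X) (id \<circ> push_mass x y) (\<lambda>_. k)"
    using nullhomotopic_through_contractible_space[OF _ _ contr] by metis
  moreover have "homotopic_with (\<lambda>_. True) (top_of_set ?X) (top_of_set ?X) id (push_mass x y)"
    by (rule homotopic_straight_line[OF cont]) (use carrier in blast)
  ultimately show ?thesis
    unfolding contractible_space_def by (metis homotopic_with_trans id_comp)
qed

text \<open>Take \<open>x\<close> maximal among the elements that are not above \<open>c\<close>. Everything strictly above \<open>x\<close> is
  above \<open>c\<close>, hence above the join \<open>y\<close> of \<open>x\<close> and \<open>c\<close>, so that \<open>x\<close> can be removed in favour
  of \<open>y\<close>. Joins with \<open>c\<close> are never removed, so they survive in the smaller poset. When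
  everything is above \<open>c\<close>, the poset is a cone.\<close>

lemma contractible_space_joins:
  fixes P :: "'a::order set"
  assumes "finite P" "c \<in> P"
    and "\<And>x. x \<in> P \<Longrightarrow> \<exists>j\<in>P. x \<le> j \<and> c \<le> j \<and> (\<forall>z\<in>P. x \<le> z \<longrightarrow> c \<le> z \<longrightarrow> j \<le> z)"
  shows "contractible_space (top_of_set (chain_space P))"
  using assms
proof (induction "card {x \<in> P. \<not> c \<le> x}" arbitrary: P)
  case 0
  then have "\<And>z. z \<in> P \<Longrightarrow> c \<le> z" by auto
  with 0 show ?case by (intro contractible_cone) auto
next
  case (Suc k)
  let ?B = "{x \<in> P. \<not> c \<le> x}"
  have "finite ?B" "?B \<noteq> {}"
    using Suc.hyps(2) by (metis card.infinite nat.distinct(1), metis card.empty nat.distinct(1))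
  then obtain x where x: "x \<in> ?B" and max: "\<And>z. z \<in> ?B \<Longrightarrow> x \<le> z \<Longrightarrow> z = x"
    using finite_has_maximal[of ?B] by metis
  obtain y where y: "y \<in> P" "x \<le> y" "c \<le> y" and least: "\<And>z. z \<in> P \<Longrightarrow> x \<le> z \<Longrightarrow> c \<le> z \<Longrightarrow> y \<le> z"
    using Suc.prems(3)[of x] x by auto
  show ?case
  proof (rule contractible_remove_beat_point)
    show "y \<in> P" "x \<noteq> y" using y x by auto
    show "z \<le> y \<or> y \<le> z" if "z \<in> P" "z \<le> x \<or> x \<le> z" for z
      using that y least[of z] max[of z] by (metis (mono_tags, lifting) mem_Collect_eq order.trans)
    show "contractible_space (top_of_set (chain_space (P - {x})))"
    proof (rule Suc.hyps(1))
      have "{z \<in> P - {x}. \<not> c \<le> z} = ?B - {x}" by auto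
      then show "k = card {z \<in> P - {x}. \<not> c \<le> z}"
        using Suc.hyps(2) x \<open>finite ?B\<close> by simp
      show "\<exists>j\<in>P - {x}. z \<le> j \<and> c \<le> j \<and> (\<forall>w\<in>P - {x}. z \<le> w \<longrightarrow> c \<le> w \<longrightarrow> j \<le> w)"
        if "z \<in> P - {x}" for z
        using Suc.prems(3)[of z] that x by blast
    qed (use Suc.prems x in auto)
  qed
qed

lemma contractible_poset_joins:
  fixes P :: "'a::order set"
  assumes "finite P" "c \<in> P"
    and "\<And>x. x \<in> P \<Longrightarrow> \<exists>j\<in>P. x \<le> j \<and> c \<le> j \<and> (\<forall>z\<in>P. x \<le> z \<longrightarrow> c \<le> z \<longrightarrow> j \<le> z)"
  shows "contractible_poset P (\<lambda>p q. q < p)"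
  unfolding contractible_poset_def realization_order_complex[OF assms(1)]
proof
  have "indicat_real {c} \<in> closed_simplex {c}" "{c} \<in> finite_chains P"
    using assms(2) by (auto simp: closed_simplex_def finite_chains_def indicator_def)
  then show "topspace (top_of_set (chain_space P)) \<noteq> {}"
    unfolding chain_space_eq_Union by auto
qed (rule contractible_space_joins[OF assms])

section \<open>Ideals of the polynomial ring\<close>

lemma poly_ring_simps [simp]:
  "carrier (poly_ring n) = poly_carrier n" "mult (poly_ring n) = (*)" "one (poly_ring n) = 1"
  "ring.zero (poly_ring n) = 0" "add (poly_ring n) = (+)"
  by (simp_all add: poly_ring_def)

interpretation poly: cring "poly_ring n :: 'k::field xypoly ring" for n
  by (rule cring_poly_ring)

lemma poly_ring_a_inv [simp]: "p \<in> poly_carrier n \<Longrightarrow> \<ominus>\<^bsub>poly_ring n\<^esub> p = - p"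
  by (rule poly.minus_equality) (simp_all add: poly_carrier_uminus)

lemma poly_carrier_minus_one: "-1 \<in> poly_carrier n"
  by (rule poly_carrier_uminus[OF poly_carrier_one])

lemma poly_idealI:
  fixes I :: "'k::field xypoly set"
  assumes "I \<subseteq> poly_carrier n" "0 \<in> I" "\<And>p q. p \<in> I \<Longrightarrow> q \<in> I \<Longrightarrow> p + q \<in> I"
    "\<And>p r. p \<in> I \<Longrightarrow> r \<in> poly_carrier n \<Longrightarrow> r * p \<in> I"
  shows "ideal I (poly_ring n)"
proof (rule idealI)
  show "ring (poly_ring n :: 'k xypoly ring)" by (rule poly.ring_axioms)
  have "- p \<in> I" if "p \<in> I" for p
    using assms(4)[OF that, of "-1"] by (simp add: poly_carrier_minus_one)
  moreover have "inv\<^bsub>add_monoid (poly_ring n)\<^esub> p = - p" if "p \<in> I" for p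
    using poly_ring_a_inv[of p n] that assms(1) unfolding a_inv_def by blast
  ultimately show "subgroup I (add_monoid (poly_ring n))"
    using assms(1-3) by (intro subgroup.intro) auto
qed (use assms in \<open>auto simp: mult.commute\<close>)

lemma poly_ideal_closed:
  fixes I :: "'k::field xypoly set"
  assumes "ideal I (poly_ring n)"
  shows "I \<subseteq> poly_carrier n" "0 \<in> I" "\<And>p q. p \<in> I \<Longrightarrow> q \<in> I \<Longrightarrow> p + q \<in> I"
    "\<And>p r. p \<in> I \<Longrightarrow> r \<in> poly_carrier n \<Longrightarrow> r * p \<in> I"
    "\<And>p. p \<in> I \<Longrightarrow> - p \<in> I" "\<And>p q. p \<in> I \<Longrightarrow> q \<in> I \<Longrightarrow> p - q \<in> I"
proof -
  interpret ideal I "poly_ring n" by fact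
  show "I \<subseteq> poly_carrier n" "0 \<in> I" and add: "\<And>p q. p \<in> I \<Longrightarrow> q \<in> I \<Longrightarrow> p + q \<in> I"
    and mult: "\<And>p r. p \<in> I \<Longrightarrow> r \<in> poly_carrier n \<Longrightarrow> r * p \<in> I"
    using a_subset zero_closed a_closed I_l_closed by simp_all
  show neg: "- p \<in> I" if "p \<in> I" for p
    using mult[OF that, of "-1"] by (simp add: poly_carrier_minus_one)
  show "p - q \<in> I" if "p \<in> I" "q \<in> I" for p q
    using add[OF that(1) neg[OF that(2)]] by simp
qed

lemma (in ring) genideal_subset_iff:
  "S \<subseteq> carrier R \<Longrightarrow> ideal I R \<Longrightarrow> Idl S \<subseteq> I \<longleftrightarrow> S \<subseteq> I"
  using genideal_minimal genideal_self by blast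

lemma (in ring) genideal_UN_genideal:
  assumes "\<And>d. d \<in> D \<Longrightarrow> S d \<subseteq> carrier R"
  shows "Idl (\<Union>d\<in>D. Idl (S d)) = Idl (\<Union>d\<in>D. S d)"
proof
  have carr: "(\<Union>d\<in>D. S d) \<subseteq> carrier R" using assms by blast
  have carr': "Idl (S d) \<subseteq> carrier R" if "d \<in> D" for d
    using ideal.Icarr[OF genideal_ideal[OF assms[OF that]]] by blast
  show "Idl (\<Union>d\<in>D. Idl (S d)) \<subseteq> Idl (\<Union>d\<in>D. S d)"
  proof (rule genideal_minimal[OF genideal_ideal[OF carr]], rule UN_least)
    fix d assume "d \<in> D"
    then show "Idl (S d) \<subseteq> Idl (\<Union>d\<in>D. S d)"
      using genideal_self[OF carr] by (intro genideal_minimal[OF genideal_ideal[OF carr]]) blast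
  qed
  show "Idl (\<Union>d\<in>D. S d) \<subseteq> Idl (\<Union>d\<in>D. Idl (S d))"
  proof (rule genideal_minimal)
    show "ideal (Idl (\<Union>d\<in>D. Idl (S d))) R"
      by (rule genideal_ideal) (use carr' in blast)
    have "(\<Union>d\<in>D. S d) \<subseteq> (\<Union>d\<in>D. Idl (S d))"
      using genideal_self[OF assms] by blast
    also have "\<dots> \<subseteq> Idl (\<Union>d\<in>D. Idl (S d))"
      by (rule genideal_self) (use carr' in blast)
    finally show "(\<Union>d\<in>D. S d) \<subseteq> Idl (\<Union>d\<in>D. Idl (S d))" .
  qed
qed

lemma (in ring) genideal_of_ideal: "ideal I R \<Longrightarrow> Idl I = I"
  using genideal_minimal[of I I] genideal_self[of I] ideal.Icarr[of I R] by blast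

lemma (in ring) genideal_Un_ideal:
  assumes S: "S \<subseteq> carrier R" and P: "ideal P R"
  shows "Idl (S \<union> P) = Idl S <+> P"
proof -
  have P': "P \<subseteq> carrier R" using ideal.Icarr[OF P] by blast
  have "Idl (Idl S \<union> P) = Idl (\<Union>b\<in>{True, False}. Idl (if b then S else P))"
    by (simp add: genideal_of_ideal[OF P])
  also have "\<dots> = Idl (\<Union>b\<in>{True, False}. if b then S else P)"
    by (rule genideal_UN_genideal) (use S P' in auto)
  finally show ?thesis
    using union_genideal[OF genideal_ideal[OF S] P] by (simp add: Un_commute)
qed

lemma (in ring) ideal_Sum_insert:
  assumes "\<And>q. q \<in> A \<Longrightarrow> ideal q R" and "ideal P R"
  shows "ideal_Sum R (insert P A) = ideal_Sum R A <+> P"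
proof -
  have "\<Union>A \<subseteq> carrier R" using ideal.Icarr[OF assms(1)] by blast
  from genideal_Un_ideal[OF this assms(2)] show ?thesis
    by (simp add: ideal_Sum_def Un_commute)
qed

text \<open>For empty \<open>A\<close> the left side would be the zero ideal, the right side \<open>P\<close>.\<close>

lemma (in ring) ideal_Sum_image_add:
  assumes "A \<noteq> {}" and A: "\<And>q. q \<in> A \<Longrightarrow> ideal q R" and P: "ideal P R"
  shows "ideal_Sum R ((\<lambda>q. q <+> P) ` A) = ideal_Sum R A <+> P"
proof -
  have carr: "\<Union>A \<subseteq> carrier R" "P \<subseteq> carrier R"
    using ideal.Icarr[OF A] ideal.Icarr[OF P] by blast+
  have "ideal_Sum R ((\<lambda>q. q <+> P) ` A) = Idl (\<Union>q\<in>A. Idl (q \<union> P))"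
    unfolding ideal_Sum_def using union_genideal[OF A P] by simp
  also have "\<dots> = Idl (\<Union>q\<in>A. q \<union> P)"
    using carr by (intro genideal_UN_genideal) blast
  also have "(\<Union>q\<in>A. q \<union> P) = \<Union>A \<union> P" using \<open>A \<noteq> {}\<close> by blast
  finally show ?thesis
    using genideal_Un_ideal[OF carr(1) P] by (simp add: ideal_Sum_def)
qed

section \<open>Ideals generated by variables and 2-minors\<close>

definition minor :: "nat \<Rightarrow> nat \<Rightarrow> 'k::field xypoly" where
  "minor i j = xv i * yv j - xv j * yv i"

definition var_minor_gens :: "nat set \<Rightarrow> (nat \<times> nat) set \<Rightarrow> 'k::field xypoly set" where
  "var_minor_gens T E = xv ` T \<union> yv ` T \<union> {minor i j | i j. (i, j) \<in> E}"

text \<open>The common shape of all the ideals at hand: \<open>T\<close> is the set of the vertices whose variables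
  vanish, and \<open>E\<close> an arbitrary set of pairs, so that sums of ideals correspond to unions of
  the sets \<open>T\<close> and \<open>E\<close>.\<close>

definition var_minor_ideal :: "nat \<Rightarrow> nat set \<Rightarrow> (nat \<times> nat) set \<Rightarrow> 'k::field xypoly set" where
  "var_minor_ideal n T E = Idl\<^bsub>poly_ring n\<^esub> (var_minor_gens T E)"

lemma var_carrier: "i \<in> {1..n} \<Longrightarrow> xv i \<in> poly_carrier n" "i \<in> {1..n} \<Longrightarrow> yv i \<in> poly_carrier n"
  by (auto simp: poly_var_def poly_carrier_def)

lemma poly_carrier_diff: "p \<in> poly_carrier n \<Longrightarrow> q \<in> poly_carrier n \<Longrightarrow> p - q \<in> poly_carrier n"
  using poly_carrier_add[of p n "- q"] poly_carrier_uminus[of q n] by simp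

lemma minor_carrier: "i \<in> {1..n} \<Longrightarrow> j \<in> {1..n} \<Longrightarrow> minor i j \<in> poly_carrier n"
  unfolding minor_def by (intro poly_carrier_diff poly_carrier_mult var_carrier)

lemma var_minor_gens_carrier:
  "T \<subseteq> {1..n} \<Longrightarrow> E \<subseteq> {1..n} \<times> {1..n} \<Longrightarrow> var_minor_gens T E \<subseteq> poly_carrier n"
  unfolding var_minor_gens_def by (auto intro!: var_carrier minor_carrier)

context
  fixes n :: nat and T :: "nat set" and E :: "(nat \<times> nat) set"
  assumes T: "T \<subseteq> {1..n}" and E: "E \<subseteq> {1..n} \<times> {1..n}"
begin

lemma ideal_var_minor_ideal: "ideal (var_minor_ideal n T E :: 'k::field xypoly set) (poly_ring n)"
  unfolding var_minor_ideal_def using var_minor_gens_carrier[OF T E]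
  by (intro poly.genideal_ideal) simp

lemma var_minor_ideal_subset_iff:
  "ideal I (poly_ring n) \<Longrightarrow>
    var_minor_ideal n T E \<subseteq> I \<longleftrightarrow> (\<forall>i\<in>T. xv i \<in> I \<and> yv i \<in> I) \<and> (\<forall>(i, j)\<in>E. minor i j \<in> I)"
  for I :: "'k::field xypoly set"
  unfolding var_minor_ideal_def
  by (subst poly.genideal_subset_iff)
    (use var_minor_gens_carrier[OF T E] in simp, assumption, auto 0 4 simp: var_minor_gens_def)

lemma var_minor_ideal_mem:
  "i \<in> T \<Longrightarrow> (xv i :: 'k::field xypoly) \<in> var_minor_ideal n T E"
  "i \<in> T \<Longrightarrow> (yv i :: 'k xypoly) \<in> var_minor_ideal n T E"
  "(i, j) \<in> E \<Longrightarrow> (minor i j :: 'k xypoly) \<in> var_minor_ideal n T E"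
  using var_minor_ideal_subset_iff[OF ideal_var_minor_ideal, where 'k = 'k] by auto

lemma minor_mem_of_vertex:
  assumes "i \<in> T \<or> j \<in> T" "i \<in> {1..n}" "j \<in> {1..n}"
  shows "(minor i j :: 'k::field xypoly) \<in> var_minor_ideal n T E"
proof -
  note J = poly_ideal_closed[OF ideal_var_minor_ideal, where 'k = 'k]
  from assms(1) have "xv i * yv j \<in> (var_minor_ideal n T E :: 'k xypoly set)
      \<and> xv j * yv i \<in> (var_minor_ideal n T E :: 'k xypoly set)"
  proof
    assume "i \<in> T"
    then have "yv j * xv i \<in> (var_minor_ideal n T E :: 'k xypoly set)"
      "xv j * yv i \<in> (var_minor_ideal n T E :: 'k xypoly set)"
      using assms(2,3) by (auto intro!: J(4) var_minor_ideal_mem var_carrier)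
    then show ?thesis by (simp add: mult.commute)
  next
    assume "j \<in> T"
    then have "xv i * yv j \<in> (var_minor_ideal n T E :: 'k xypoly set)"
      "yv i * xv j \<in> (var_minor_ideal n T E :: 'k xypoly set)"
      using assms(2,3) by (auto intro!: J(4) var_minor_ideal_mem var_carrier)
    then show ?thesis by (simp add: mult.commute)
  qed
  then show ?thesis using J(6) by (simp add: minor_def)
qed

end

definition var_minor_ideals :: "nat \<Rightarrow> (nat \<times> nat) set \<Rightarrow> 'k::field xypoly set set" where
  "var_minor_ideals n E0 = (\<lambda>(T, E). var_minor_ideal n T E) ` (Pow {1..n} \<times> Pow E0)"

lemma var_minor_idealsI:
  "T \<subseteq> {1..n} \<Longrightarrow> E \<subseteq> E0 \<Longrightarrow> var_minor_ideal n T E \<in> var_minor_ideals n E0"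
  unfolding var_minor_ideals_def by (rule image_eqI[of _ _ "(T, E)"]) auto

lemma var_minor_idealsE:
  assumes "I \<in> var_minor_ideals n E0"
  obtains T E where "I = var_minor_ideal n T E" "T \<subseteq> {1..n}" "E \<subseteq> E0"
  using assms unfolding var_minor_ideals_def by auto

lemma ideal_Sum_var_minor_ideals:
  fixes A :: "'k::field xypoly set set"
  assumes "A \<subseteq> var_minor_ideals n E0" and "E0 \<subseteq> {1..n} \<times> {1..n}"
  shows "ideal_Sum (poly_ring n) A \<in> var_minor_ideals n E0"
proof -
  obtain D where D: "D \<subseteq> Pow {1..n} \<times> Pow E0" "A = (\<lambda>(T, E). var_minor_ideal n T E) ` D"
    using assms(1) unfolding var_minor_ideals_def by (auto simp: subset_image_iff)
  have "ideal_Sum (poly_ring n) A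
      = Idl\<^bsub>poly_ring n\<^esub> (\<Union>d\<in>D. Idl\<^bsub>poly_ring n\<^esub> (var_minor_gens (fst d) (snd d)))"
    by (simp add: ideal_Sum_def D(2) var_minor_ideal_def case_prod_unfold)
  also have "\<dots> = Idl\<^bsub>poly_ring n\<^esub> (\<Union>d\<in>D. var_minor_gens (fst d) (snd d))"
  proof (rule poly.genideal_UN_genideal)
    fix d assume "d \<in> D"
    then have "fst d \<subseteq> {1..n}" "snd d \<subseteq> {1..n} \<times> {1..n}"
      using subsetD[OF D(1)] assms(2) unfolding mem_Times_iff Pow_iff by blast+
    then show "var_minor_gens (fst d) (snd d) \<subseteq> carrier (poly_ring n :: 'k xypoly ring)"
      unfolding poly_ring_simps by (rule var_minor_gens_carrier)
  qed
  also have "(\<Union>d\<in>D. var_minor_gens (fst d) (snd d))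
      = (var_minor_gens (\<Union>(fst ` D)) (\<Union>(snd ` D)) :: 'k xypoly set)"
    by (auto simp: var_minor_gens_def; blast)
  finally have "ideal_Sum (poly_ring n) A = var_minor_ideal n (\<Union>(fst ` D)) (\<Union>(snd ` D))"
    by (simp add: var_minor_ideal_def)
  moreover have "\<Union>(fst ` D) \<subseteq> {1..n}" "\<Union>(snd ` D) \<subseteq> E0"
    using subsetD[OF D(1)] unfolding mem_Times_iff Pow_iff by blast+
  ultimately show ?thesis by (simp only: var_minor_idealsI)
qed

section \<open>Evaluation along a map on monomials\<close>

text \<open>The linear extension of a map \<open>h\<close> on monomials; it is a ring homomorphism when \<open>h\<close> is
  multiplicative.\<close>

definition monomial_eval ::
    "('m \<Rightarrow> ('g::comm_monoid_add \<Rightarrow>\<^sub>0 'k)) \<Rightarrow> ('m \<Rightarrow>\<^sub>0 'k::field) \<Rightarrow> ('g \<Rightarrow>\<^sub>0 'k)" where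
  "monomial_eval h p =
     (\<Sum>m\<in>Poly_Mapping.keys p. Poly_Mapping.single 0 (Poly_Mapping.lookup p m) * h m)"

lemma poly_mapping_sum_singles:
  "(\<Sum>m\<in>Poly_Mapping.keys p. Poly_Mapping.single m (Poly_Mapping.lookup p m)) = p"
  by (rule poly_mapping_eqI)
    (auto simp: lookup_sum lookup_single when_def in_keys_iff sum.delta)

lemma monomial_eval_superset:
  assumes "finite A" "Poly_Mapping.keys p \<subseteq> A"
  shows "monomial_eval h p = (\<Sum>m\<in>A. Poly_Mapping.single 0 (Poly_Mapping.lookup p m) * h m)"
  unfolding monomial_eval_def
  by (rule sum.mono_neutral_left) (use assms in \<open>auto simp: in_keys_iff\<close>)

lemma monomial_eval_add: "monomial_eval h (p + q) = monomial_eval h p + monomial_eval h q"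
proof -
  let ?A = "Poly_Mapping.keys p \<union> Poly_Mapping.keys q"
  have "Poly_Mapping.keys (p + q) \<subseteq> ?A" by (rule Poly_Mapping.keys_add)
  then show ?thesis
    using monomial_eval_superset[of ?A "p + q" h] monomial_eval_superset[of ?A p h]
      monomial_eval_superset[of ?A q h]
    by (simp add: lookup_add single_add distrib_right sum.distrib)
qed

lemma monomial_eval_0 [simp]: "monomial_eval h 0 = 0"
  by (simp add: monomial_eval_def)

lemma monomial_eval_single [simp]:
  "monomial_eval h (Poly_Mapping.single m c) = Poly_Mapping.single 0 c * h m"
  by (simp add: monomial_eval_def)

lemma monomial_eval_sum: "monomial_eval h (sum p A) = (\<Sum>a\<in>A. monomial_eval h (p a))"
  by (induction A rule: infinite_finite_induct) (simp_all add: monomial_eval_add)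

lemma monomial_eval_uminus: "monomial_eval h (- p) = - monomial_eval h p"
  using monomial_eval_add[of h p "- p"] by (simp add: eq_neg_iff_add_eq_0 add.commute)

lemma monomial_eval_diff: "monomial_eval h (p - q) = monomial_eval h p - monomial_eval h q"
  using monomial_eval_add[of h p "- q"] by (simp add: monomial_eval_uminus)

lemma monomial_eval_mult:
  fixes h :: "'m::comm_monoid_add \<Rightarrow> ('g::comm_monoid_add \<Rightarrow>\<^sub>0 'k::field)"
  assumes h: "\<And>a b. h (a + b) = h a * h b"
  shows "monomial_eval h (p * q) = monomial_eval h p * monomial_eval h q"
proof -
  have "p * q = (\<Sum>a\<in>Poly_Mapping.keys p. \<Sum>b\<in>Poly_Mapping.keys q.
      Poly_Mapping.single (a + b) (Poly_Mapping.lookup p a * Poly_Mapping.lookup q b))"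
    by (subst (1) poly_mapping_sum_singles[of p, symmetric],
        subst (1) poly_mapping_sum_singles[of q, symmetric])
      (simp add: sum_product mult_single)
  moreover have "Poly_Mapping.single 0 (c * d) * h (a + b)
      = (Poly_Mapping.single 0 c * h a) * (Poly_Mapping.single 0 d * h b)" for a b c d
  proof -
    have "Poly_Mapping.single (0::'g) (c * d) = Poly_Mapping.single 0 c * Poly_Mapping.single 0 d"
      by (simp add: mult_single)
    then show ?thesis by (simp add: h ac_simps)
  qed
  ultimately show ?thesis
    by (simp add: monomial_eval_sum) (simp add: monomial_eval_def sum_product)
qed

section \<open>Prime ideals as kernels of monomial maps\<close>

abbreviation xexp :: "(xyvar \<Rightarrow>\<^sub>0 nat) \<Rightarrow> nat \<Rightarrow> nat" where
  "xexp m i \<equiv> Poly_Mapping.lookup m (Xvar i)"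

abbreviation yexp :: "(xyvar \<Rightarrow>\<^sub>0 nat) \<Rightarrow> nat \<Rightarrow> nat" where
  "yexp m i \<equiv> Poly_Mapping.lookup m (Yvar i)"

text \<open>The exponent vector of the image of a monomial under \<open>x\<^sub>i \<mapsto> u\<^sub>i s\<^bsub>\<beta> i\<^esub>\<close>, \<open>y\<^sub>i \<mapsto> u\<^sub>i\<close>,
  where \<open>\<beta> i\<close> names the block of \<open>i\<close>. The new variables are numbered by natural numbers,
  \<open>u\<^sub>i\<close> by \<open>2 i\<close> and \<open>s\<^sub>l\<close> by \<open>2 l + 1\<close>: their linear order induces one on the exponent
  vectors, which makes the target ring a domain. The map kills the 2-minors inside the blocks. It is
  the usual parametrization \<open>x\<^sub>i \<mapsto> u\<^sub>i s\<^sub>l\<close>, \<open>y\<^sub>i \<mapsto> u\<^sub>i t\<^sub>l\<close> of matrices of rank one with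
  \<open>t\<^sub>l = 1\<close>.\<close>

definition toric_exp :: "nat \<Rightarrow> (nat \<Rightarrow> nat) \<Rightarrow> (xyvar \<Rightarrow>\<^sub>0 nat) \<Rightarrow> (nat \<Rightarrow>\<^sub>0 nat)" where
  "toric_exp n \<beta> m = (\<Sum>i\<in>{1..n}. Poly_Mapping.single (2 * i) (xexp m i + yexp m i)
      + Poly_Mapping.single (2 * \<beta> i + 1) (xexp m i))"

definition avoids :: "nat set \<Rightarrow> (xyvar \<Rightarrow>\<^sub>0 nat) \<Rightarrow> bool" where
  "avoids T m \<longleftrightarrow> (\<forall>i\<in>T. xexp m i = 0 \<and> yexp m i = 0)"

definition toric_monomial ::
    "nat \<Rightarrow> nat set \<Rightarrow> (nat \<Rightarrow> nat) \<Rightarrow> (xyvar \<Rightarrow>\<^sub>0 nat) \<Rightarrow> ((nat \<Rightarrow>\<^sub>0 nat) \<Rightarrow>\<^sub>0 'k::field)" where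
  "toric_monomial n T \<beta> m = (if avoids T m then Poly_Mapping.single (toric_exp n \<beta> m) 1 else 0)"

abbreviation toric_map ::
    "nat \<Rightarrow> nat set \<Rightarrow> (nat \<Rightarrow> nat) \<Rightarrow> 'k::field xypoly \<Rightarrow> ((nat \<Rightarrow>\<^sub>0 nat) \<Rightarrow>\<^sub>0 'k)" where
  "toric_map n T \<beta> \<equiv> monomial_eval (toric_monomial n T \<beta>)"

lemma toric_exp_add: "toric_exp n \<beta> (a + b) = toric_exp n \<beta> a + toric_exp n \<beta> b"
  unfolding toric_exp_def sum.distrib[symmetric]
  by (rule sum.cong) (simp_all add: lookup_add single_add ac_simps)

lemma avoids_add: "avoids T (a + b) \<longleftrightarrow> avoids T a \<and> avoids T b"
  by (auto simp: avoids_def lookup_add)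

lemma toric_monomial_add:
  "toric_monomial n T \<beta> (a + b) = toric_monomial n T \<beta> a * toric_monomial n T \<beta> b"
  by (simp add: toric_monomial_def avoids_add toric_exp_add mult_single)

lemma toric_map_mult: "toric_map n T \<beta> (p * q) = toric_map n T \<beta> p * toric_map n T \<beta> q"
  by (rule monomial_eval_mult) (rule toric_monomial_add)

lemma toric_exp_0 [simp]: "toric_exp n \<beta> 0 = 0"
  by (simp add: toric_exp_def)

lemma toric_map_1: "toric_map n T \<beta> 1 = 1"
  unfolding single_one[symmetric] monomial_eval_single
  by (simp add: toric_monomial_def avoids_def mult_single)

lemma lookup_toric_exp_even:
  assumes "i \<in> {1..n}"
  shows "Poly_Mapping.lookup (toric_exp n \<beta> m) (2 * i) = xexp m i + yexp m i"
proof -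
  have "(2 * \<beta> k + 1 = 2 * i) = False" for k by presburger
  then show ?thesis
    using assms by (simp add: toric_exp_def lookup_sum lookup_add lookup_single when_def sum.delta)
qed

lemma lookup_toric_exp_odd:
  "Poly_Mapping.lookup (toric_exp n \<beta> m) (2 * l + 1) = (\<Sum>i\<in>{i\<in>{1..n}. \<beta> i = l}. xexp m i)"
proof -
  have "(2 * k = 2 * l + 1) = False" for k by presburger
  then show ?thesis
    unfolding sum.inter_filter[OF finite_atLeastAtMost]
    by (simp add: toric_exp_def lookup_sum lookup_add lookup_single when_def)
qed

lemma toric_exp_vars:
  assumes "i \<in> {1..n}"
  shows "toric_exp n \<beta> (Poly_Mapping.single (Xvar i) 1)
      = Poly_Mapping.single (2 * i) 1 + Poly_Mapping.single (2 * \<beta> i + 1) 1"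
    and "toric_exp n \<beta> (Poly_Mapping.single (Yvar i) 1) = Poly_Mapping.single (2 * i) 1"
proof -
  have "toric_exp n \<beta> (Poly_Mapping.single (Xvar i) 1)
     = (\<Sum>k\<in>{1..n}. if k = i then Poly_Mapping.single (2 * i) 1 + Poly_Mapping.single (2 * \<beta> i + 1) 1 else 0)"
    unfolding toric_exp_def by (rule sum.cong) (auto simp: lookup_single)
  then show "toric_exp n \<beta> (Poly_Mapping.single (Xvar i) 1)
      = Poly_Mapping.single (2 * i) 1 + Poly_Mapping.single (2 * \<beta> i + 1) 1"
    using assms by simp
  have "toric_exp n \<beta> (Poly_Mapping.single (Yvar i) 1)
     = (\<Sum>k\<in>{1..n}. if k = i then Poly_Mapping.single (2 * i) 1 else 0)"
    unfolding toric_exp_def by (rule sum.cong) (auto simp: lookup_single)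
  then show "toric_exp n \<beta> (Poly_Mapping.single (Yvar i) 1) = Poly_Mapping.single (2 * i) 1"
    using assms by simp
qed

definition label_pairs :: "nat \<Rightarrow> nat set \<Rightarrow> (nat \<Rightarrow> nat) \<Rightarrow> (nat \<times> nat) set" where
  "label_pairs n T \<beta> = {(i, j). i \<in> {1..n} - T \<and> j \<in> {1..n} - T \<and> \<beta> i = \<beta> j}"

lemma label_pairs_subset: "label_pairs n T \<beta> \<subseteq> {1..n} \<times> {1..n}"
  by (auto simp: label_pairs_def)

lemma toric_map_minor:
  assumes "i \<in> {1..n}" "j \<in> {1..n}" "\<beta> i = \<beta> j" "i \<notin> T" "j \<notin> T"
  shows "toric_map n T \<beta> (minor i j :: 'k::field xypoly) = 0"
proof -
  have "toric_map n T \<beta> (xv a * yv b :: 'k xypoly) =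
     (Poly_Mapping.single (Poly_Mapping.single (2 * a) 1 + Poly_Mapping.single (2 * \<beta> a + 1) 1
        + Poly_Mapping.single (2 * b) 1) 1 :: _ \<Rightarrow>\<^sub>0 'k)" if "a \<in> {i, j}" "b \<in> {i, j}" for a b
    using that assms
    by (auto simp: poly_var_def mult_single toric_monomial_def avoids_def lookup_add lookup_single when_def
        toric_exp_add toric_exp_vars[simplified])
  then show ?thesis
    using assms by (simp add: minor_def monomial_eval_diff ac_simps)
qed

lemma poly_carrier_single_iff:
  "(Poly_Mapping.single m (1::'k::field)) \<in> poly_carrier n
    \<longleftrightarrow> Poly_Mapping.keys m \<subseteq> Xvar ` {1..n} \<union> Yvar ` {1..n}"
  by (simp add: poly_carrier_def)

lemma monomial_eqI:
  assumes "Poly_Mapping.keys m \<subseteq> Xvar ` {1..n} \<union> Yvar ` {1..n}"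
    "Poly_Mapping.keys m' \<subseteq> Xvar ` {1..n} \<union> Yvar ` {1..n}"
    "\<And>i. i \<in> {1..n} \<Longrightarrow> xexp m i = xexp m' i \<and> yexp m i = yexp m' i"
  shows "m = m'"
proof (rule poly_mapping_eqI)
  fix v
  show "Poly_Mapping.lookup m v = Poly_Mapping.lookup m' v"
  proof (cases "v \<in> Poly_Mapping.keys m \<union> Poly_Mapping.keys m'")
    case True
    then show ?thesis using assms by blast
  qed (simp add: in_keys_iff)
qed

text \<open>Two monomials with the same image have the same degree in each pair \<open>x\<^sub>i, y\<^sub>i\<close> and the same
  total \<open>x\<close>-degree in each block. If \<open>m\<close> has too many factors \<open>x\<^sub>i\<close>, compared with \<open>m'\<close>, then some \<open>j\<close>
  in the same block has too few factors \<open>x\<^sub>j\<close>, hence too many \<open>y\<^sub>j\<close>, and trading \<open>x\<^sub>i y\<^sub>j\<close> for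
  \<open>x\<^sub>j y\<^sub>i\<close> changes \<open>m\<close> by a multiple of a minor and brings it closer to \<open>m'\<close>.\<close>

lemma binomial_in_var_minor_ideal:
  fixes m m' :: "xyvar \<Rightarrow>\<^sub>0 nat"
  assumes T: "T \<subseteq> {1..n}"
    and "Poly_Mapping.keys m \<subseteq> Xvar ` {1..n} \<union> Yvar ` {1..n}" "avoids T m"
    and m': "Poly_Mapping.keys m' \<subseteq> Xvar ` {1..n} \<union> Yvar ` {1..n}" "avoids T m'"
    and "toric_exp n \<beta> m = toric_exp n \<beta> m'"
  shows "Poly_Mapping.single m 1 - Poly_Mapping.single m' (1::'k::field)
      \<in> var_minor_ideal n T (label_pairs n T \<beta>)"
  using assms(2,3,6)
proof (induction "\<Sum>i\<in>{1..n}. xexp m i - xexp m' i" arbitrary: m)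
  case 0
  let ?J = "var_minor_ideal n T (label_pairs n T \<beta>) :: 'k xypoly set"
  have le: "xexp m i \<le> xexp m' i" if "i \<in> {1..n}" for i
    using 0(1) that by simp
  have "xexp m i = xexp m' i" if i: "i \<in> {1..n}" for i
  proof (rule ccontr)
    assume "xexp m i \<noteq> xexp m' i"
    then have "(\<Sum>k\<in>{k\<in>{1..n}. \<beta> k = \<beta> i}. xexp m k) < (\<Sum>k\<in>{k\<in>{1..n}. \<beta> k = \<beta> i}. xexp m' k)"
      using le i by (intro sum_strict_mono_ex1) (auto intro!: bexI[of _ i] simp: le_less)
    then show False
      using 0(4) lookup_toric_exp_odd[of n \<beta> m "\<beta> i"] lookup_toric_exp_odd[of n \<beta> m' "\<beta> i"] by simp
  qed
  moreover from this have "yexp m i = yexp m' i" if "i \<in> {1..n}" for i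
    using lookup_toric_exp_even[OF that, of \<beta> m] lookup_toric_exp_even[OF that, of \<beta> m'] 0(4) that
    by simp
  ultimately have "m = m'"
    using monomial_eqI[OF 0(2) m'(1)] by blast
  then show ?case
    using poly_ideal_closed(2)[OF ideal_var_minor_ideal[OF T label_pairs_subset]] by simp
next
  case (Suc N)
  let ?J = "var_minor_ideal n T (label_pairs n T \<beta>) :: 'k xypoly set"
  note J = poly_ideal_closed[OF ideal_var_minor_ideal[OF T label_pairs_subset, where 'k = 'k]]
  have "\<exists>i\<in>{1..n}. xexp m i - xexp m' i \<noteq> 0"
    using Suc(2) by (metis (no_types, lifting) nat.distinct(1) sum.neutral)
  then obtain i where i: "i \<in> {1..n}" "xexp m' i < xexp m i" by auto
  have sums: "(\<Sum>k\<in>{k\<in>{1..n}. \<beta> k = \<beta> i}. xexp m k) = (\<Sum>k\<in>{k\<in>{1..n}. \<beta> k = \<beta> i}. xexp m' k)"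
    using Suc(5) lookup_toric_exp_odd[of n \<beta> m "\<beta> i"] lookup_toric_exp_odd[of n \<beta> m' "\<beta> i"] by simp
  have "\<exists>j\<in>{1..n}. \<beta> j = \<beta> i \<and> xexp m j < xexp m' j"
  proof (rule ccontr)
    assume "\<not> ?thesis"
    then have "(\<Sum>k\<in>{k\<in>{1..n}. \<beta> k = \<beta> i}. xexp m' k) < (\<Sum>k\<in>{k\<in>{1..n}. \<beta> k = \<beta> i}. xexp m k)"
      using i by (intro sum_strict_mono_ex1) (auto intro!: bexI[of _ i] simp: not_less)
    then show False using sums by simp
  qed
  then obtain j where j: "j \<in> {1..n}" "\<beta> j = \<beta> i" "xexp m j < xexp m' j" by blast
  have "yexp m j > 0"
    using lookup_toric_exp_even[OF j(1), of \<beta> m] lookup_toric_exp_even[OF j(1), of \<beta> m'] Suc(5) j(3)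
    by simp
  have ij: "i \<noteq> j" "i \<notin> T" "j \<notin> T"
    using i j Suc(4) m'(2) by (auto simp: avoids_def)
  define e where "e = (\<lambda>v::xyvar. Poly_Mapping.single v (1::nat))"
  define m0 where "m0 = m - (e (Xvar i) + e (Yvar j))"
  define m1 where "m1 = m0 + (e (Xvar j) + e (Yvar i))"
  have m: "m = m0 + (e (Xvar i) + e (Yvar j))"
    by (rule poly_mapping_eqI)
      (use i(2) \<open>yexp m j > 0\<close> in \<open>auto simp: m0_def e_def lookup_add lookup_minus lookup_single when_def\<close>)
  have keys_m0: "Poly_Mapping.keys m0 \<subseteq> Xvar ` {1..n} \<union> Yvar ` {1..n}"
  proof -
    have "Poly_Mapping.keys m0 \<subseteq> Poly_Mapping.keys m"
      by (auto simp: m in_keys_iff lookup_add)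
    then show ?thesis using Suc(3) by blast
  qed
  have "Poly_Mapping.keys m1 \<subseteq> Poly_Mapping.keys m0 \<union> {Xvar j, Yvar i}"
    by (auto simp: m1_def e_def in_keys_iff lookup_add lookup_single when_def split: if_splits)
  then have m1: "Poly_Mapping.keys m1 \<subseteq> Xvar ` {1..n} \<union> Yvar ` {1..n}"
    using keys_m0 i(1) j(1) by auto
  moreover have "avoids T m1"
    using Suc(4) ij unfolding m m1_def avoids_add
    by (auto simp: avoids_def e_def lookup_single when_def)
  moreover have "toric_exp n \<beta> m1 = toric_exp n \<beta> m'"
    using i(1) j(1,2) unfolding Suc(5)[symmetric] m m1_def e_def
    by (simp add: toric_exp_add toric_exp_vars[simplified] ac_simps)
  moreover have "N = (\<Sum>k\<in>{1..n}. xexp m1 k - xexp m' k)"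
  proof -
    have m1_i: "xexp m i = Suc (xexp m1 i)" and m1_j: "xexp m1 j = Suc (xexp m j)"
      using ij by (auto simp: m m1_def e_def lookup_add lookup_single when_def)
    have m1_other: "xexp m1 k = xexp m k" if "k \<noteq> i" "k \<noteq> j" for k
      using that by (auto simp: m m1_def e_def lookup_add lookup_single when_def)
    have "(\<Sum>k\<in>{1..n}. xexp m k - xexp m' k)
        = (\<Sum>k\<in>{1..n}. (xexp m1 k - xexp m' k) + (if k = i then 1 else 0))"
    proof (intro sum.cong refl)
      fix k
      show "xexp m k - xexp m' k = (xexp m1 k - xexp m' k) + (if k = i then 1 else 0)"
        using m1_i m1_j m1_other[of k] i(2) j(3) ij(1)
        by (cases "k = i"; cases "k = j") simp_all
    qed
    then show ?thesis
      using Suc(2) i(1) by (simp add: sum.distrib)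
  qed
  ultimately have "Poly_Mapping.single m1 1 - Poly_Mapping.single m' 1 \<in> ?J"
    using Suc(1) by blast
  moreover have "Poly_Mapping.single m 1 - Poly_Mapping.single m1 1 \<in> ?J"
  proof -
    have "(i, j) \<in> label_pairs n T \<beta>" using i j ij by (auto simp: label_pairs_def)
    then have "Poly_Mapping.single m0 1 * minor i j \<in> ?J"
      using var_minor_ideal_mem(3)[OF T label_pairs_subset] keys_m0
      by (intro J(4)) (auto simp: poly_carrier_single_iff)
    moreover have "Poly_Mapping.single m0 1 * minor i j
        = Poly_Mapping.single m 1 - Poly_Mapping.single m1 (1::'k)"
      unfolding m m1_def e_def
      by (simp add: minor_def poly_var_def mult_single right_diff_distrib ac_simps)
    ultimately show ?thesis by simp
  qed
  ultimately have "(Poly_Mapping.single m 1 - Poly_Mapping.single m1 1)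
      + (Poly_Mapping.single m1 1 - Poly_Mapping.single m' 1) \<in> ?J"
    by (intro J(3))
  then show ?case by simp
qed

lemma single_times: "Poly_Mapping.single 0 c * Poly_Mapping.single m d = Poly_Mapping.single m (c * d)"
  for m :: "'a::comm_monoid_add"
  by (simp add: mult_single)

text \<open>The kernel of a map that sends monomials to monomials or to zero is spanned by the monomials
  sent to zero and by the differences of monomials with equal images. The induction splits off one such
  element at a time, each removing a monomial from the support.\<close>

lemma toric_kernel_subset:
  fixes p :: "'k::field xypoly"
  assumes T: "T \<subseteq> {1..n}" and "p \<in> poly_carrier n" "toric_map n T \<beta> p = 0"
  shows "p \<in> var_minor_ideal n T (label_pairs n T \<beta>)"
  using assms(2,3)
proof (induction "card (Poly_Mapping.keys p)" arbitrary: p rule: less_induct)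
  case less
  let ?J = "var_minor_ideal n T (label_pairs n T \<beta>) :: 'k xypoly set"
  note J = poly_ideal_closed[OF ideal_var_minor_ideal[OF T label_pairs_subset, where 'k = 'k]]
  have const: "Poly_Mapping.single 0 c \<in> poly_carrier n" for c :: 'k
    by (simp add: poly_carrier_def)
  have keys_carrier: "Poly_Mapping.keys m \<subseteq> Xvar ` {1..n} \<union> Yvar ` {1..n}" if "m \<in> Poly_Mapping.keys p" for m
    using less(2) that by (auto simp: poly_carrier_def)
  have reduce: "p \<in> ?J" if m: "m \<in> Poly_Mapping.keys p" and r: "r \<in> ?J" "toric_map n T \<beta> r = 0"
    "Poly_Mapping.keys r \<subseteq> Poly_Mapping.keys p" "Poly_Mapping.lookup r m = Poly_Mapping.lookup p m" for m r
  proof -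
    have "Poly_Mapping.keys (p - r) \<subseteq> Poly_Mapping.keys p - {m}"
      using Poly_Mapping.keys_diff[of p r] r(3,4) by (auto simp: in_keys_iff lookup_minus)
    then have "card (Poly_Mapping.keys (p - r)) < card (Poly_Mapping.keys p)"
      using m by (intro psubset_card_mono finite_keys) blast
    moreover have "p - r \<in> poly_carrier n"
      using less(2) J(1) r(1) by (intro poly_carrier_diff) auto
    ultimately have "p - r \<in> ?J"
      using less(1)[of "p - r"] less(3) r(2) by (simp add: monomial_eval_diff)
    from J(3)[OF this r(1)] show ?thesis by simp
  qed
  show ?case
  proof (cases "p = 0")
    case False
    then obtain m where m: "m \<in> Poly_Mapping.keys p"
      using keys_eq_empty[of p] by blast
    let ?c = "Poly_Mapping.lookup p m"
    show ?thesis
    proof (cases "avoids T m")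
      case False
      then obtain i where "i \<in> T" "xexp m i \<noteq> 0 \<or> yexp m i \<noteq> 0"
        unfolding avoids_def by blast
      then obtain v where i: "i \<in> T" "v = Xvar i \<or> v = Yvar i" "Poly_Mapping.lookup m v \<noteq> 0"
        by blast
      define m0 where "m0 = m - Poly_Mapping.single v 1"
      have m_eq: "m = m0 + Poly_Mapping.single v 1"
        by (rule poly_mapping_eqI) (use i(3) in \<open>auto simp: m0_def lookup_add lookup_minus lookup_single when_def\<close>)
      have "poly_var v \<in> ?J"
        using i var_minor_ideal_mem[OF T label_pairs_subset] by blast
      moreover have "Poly_Mapping.single m0 ?c \<in> poly_carrier n"
      proof -
        have "Poly_Mapping.keys m0 \<subseteq> Poly_Mapping.keys m"
          by (auto simp: m_eq in_keys_iff lookup_add)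
        then show ?thesis using keys_carrier[OF m] by (auto simp: poly_carrier_def)
      qed
      ultimately have "Poly_Mapping.single m0 ?c * poly_var v \<in> ?J" by (rule J(4))
      then have "Poly_Mapping.single m ?c \<in> ?J"
        by (subst m_eq) (simp add: poly_var_def mult_single)
      then show ?thesis
        by (rule reduce[OF m]) (use False m in \<open>simp_all add: toric_monomial_def in_keys_iff\<close>)
    next
      case True
      \<comment> \<open>Otherwise nothing would cancel the image of \<open>m\<close>.\<close>
      have "\<exists>m'\<in>Poly_Mapping.keys p. m' \<noteq> m \<and> avoids T m' \<and> toric_exp n \<beta> m' = toric_exp n \<beta> m"
      proof (rule ccontr)
        assume no: "\<not> ?thesis"
        have "Poly_Mapping.lookup (toric_map n T \<beta> p) (toric_exp n \<beta> m)
          = (\<Sum>m'\<in>Poly_Mapping.keys p. if m' = m then ?c else 0)"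
          unfolding monomial_eval_def lookup_sum
        proof (rule sum.cong[OF refl])
          fix m' assume "m' \<in> Poly_Mapping.keys p"
          then have "m' = m \<or> \<not> avoids T m' \<or> toric_exp n \<beta> m' \<noteq> toric_exp n \<beta> m"
            using no by blast
          then show "Poly_Mapping.lookup (Poly_Mapping.single 0 (Poly_Mapping.lookup p m')
              * toric_monomial n T \<beta> m') (toric_exp n \<beta> m) = (if m' = m then ?c else 0)"
            using True by (auto simp: toric_monomial_def mult_single lookup_single when_def)
        qed
        also have "\<dots> = ?c" using m by simp
        finally show False using less(3) m by (simp add: in_keys_iff)
      qed
      then obtain m' where m': "m' \<in> Poly_Mapping.keys p" "m' \<noteq> m" "avoids T m'"
        "toric_exp n \<beta> m' = toric_exp n \<beta> m" by blast
      let ?r = "Poly_Mapping.single m ?c - Poly_Mapping.single m' ?c"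
      have "Poly_Mapping.single 0 ?c * (Poly_Mapping.single m 1 - Poly_Mapping.single m' 1) \<in> ?J"
        using binomial_in_var_minor_ideal[OF T keys_carrier[OF m] True keys_carrier[OF m'(1)] m'(3) m'(4)[symmetric]]
        by (rule J(4)[OF _ const])
      then have "?r \<in> ?J"
        by (simp add: right_diff_distrib single_times)
      moreover have "toric_map n T \<beta> ?r = 0"
        using m'(3,4) True by (simp add: toric_monomial_def monomial_eval_diff)
      moreover have "Poly_Mapping.keys ?r \<subseteq> {m, m'}"
        by (auto simp: in_keys_iff lookup_minus lookup_single when_def split: if_splits)
      then have "Poly_Mapping.keys ?r \<subseteq> Poly_Mapping.keys p"
        using m m'(1) by blast
      moreover have "Poly_Mapping.lookup ?r m = ?c"
        using m'(2) by (simp add: lookup_minus lookup_single_not_eq)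
      ultimately show ?thesis
        by (rule reduce[OF m])
    qed
  qed (simp add: J(2))
qed

lemma var_minor_ideal_label_pairs:
  assumes T: "T \<subseteq> {1..n}"
  shows "var_minor_ideal n T (label_pairs n T \<beta>)
      = {p \<in> poly_carrier n. toric_map n T \<beta> p = (0 :: (nat \<Rightarrow>\<^sub>0 nat) \<Rightarrow>\<^sub>0 'k::field)}" (is "_ = ?K")
proof
  have ideal: "ideal ?K (poly_ring n)"
    by (rule poly_idealI)
      (auto simp: poly_carrier_zero poly_carrier_add poly_carrier_mult monomial_eval_add toric_map_mult)
  have "toric_map n T \<beta> (xv i) = (0 :: _ \<Rightarrow>\<^sub>0 'k)" "toric_map n T \<beta> (yv i) = (0 :: _ \<Rightarrow>\<^sub>0 'k)" if "i \<in> T" for i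
    using that by (auto simp: poly_var_def toric_monomial_def avoids_def lookup_single when_def)
  then show "var_minor_ideal n T (label_pairs n T \<beta>) \<subseteq> ?K"
    unfolding var_minor_ideal_subset_iff[OF T label_pairs_subset ideal]
    using T by (auto simp: label_pairs_def intro!: toric_map_minor var_carrier minor_carrier)
qed (use toric_kernel_subset[OF T] in auto)

lemma equiv_label:
  fixes R :: "(nat \<times> nat) set"
  assumes "equiv ({1..n} - T) R"
  obtains \<beta> where "R = label_pairs n T \<beta>"
proof
  define \<beta> where "\<beta> i = (LEAST j. (i, j) \<in> R)" for i
  have \<beta>: "(i, \<beta> i) \<in> R" if "i \<in> {1..n} - T" for i
    unfolding \<beta>_def by (rule LeastI[of _ i]) (use assms that in \<open>auto simp: equiv_def refl_on_def\<close>)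
  have "\<beta> i = \<beta> j" if "(i, j) \<in> R" for i j
  proof -
    have "R `` {i} = R `` {j}" using assms that by (rule equiv_class_eq)
    then have "(i, k) \<in> R \<longleftrightarrow> (j, k) \<in> R" for k by blast
    then show ?thesis by (simp add: \<beta>_def)
  qed
  moreover have "(i, j) \<in> R" if "i \<in> {1..n} - T" "j \<in> {1..n} - T" "\<beta> i = \<beta> j" for i j
    using \<beta>[OF that(1)] \<beta>[OF that(2)] that(3) assms
    by (metis equiv_def symE transE)
  moreover have "R \<subseteq> ({1..n} - T) \<times> ({1..n} - T)"
    using assms by (simp add: equiv_type)
  ultimately show "R = label_pairs n T \<beta>"
    unfolding label_pairs_def by blast
qed

lemma primeideal_var_minor_ideal:
  assumes T: "T \<subseteq> {1..n}" and "equiv ({1..n} - T) R"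
  shows "primeideal (var_minor_ideal n T R :: 'k::field xypoly set) (poly_ring n)"
proof -
  obtain \<beta> where R: "R = label_pairs n T \<beta>" using equiv_label[OF assms(2)] .
  show ?thesis
  proof (rule primeidealI)
    show "ideal (var_minor_ideal n T R :: 'k xypoly set) (poly_ring n)"
      unfolding R by (rule ideal_var_minor_ideal[OF T label_pairs_subset])
    have "(1 :: 'k xypoly) \<notin> var_minor_ideal n T R"
      unfolding R var_minor_ideal_label_pairs[OF T] by (simp add: toric_map_1)
    then show "carrier (poly_ring n) \<noteq> (var_minor_ideal n T R :: 'k xypoly set)"
      using poly_carrier_one by force
    show "p \<in> var_minor_ideal n T R \<or> q \<in> var_minor_ideal n T R"
      if "p \<in> carrier (poly_ring n)" "q \<in> carrier (poly_ring n)"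
        "p \<otimes>\<^bsub>poly_ring n\<^esub> q \<in> var_minor_ideal n T R" for p q :: "'k xypoly"
      using that unfolding R var_minor_ideal_label_pairs[OF T] by (auto simp: toric_map_mult)
  qed (rule cring_poly_ring)
qed

lemma single_one_neq_0: "Poly_Mapping.single k (1 :: 'a::zero_neq_one) \<noteq> 0"
  by (metis lookup_single_eq lookup_zero zero_neq_one)

lemma xvar_notin_var_minor_ideal:
  assumes T: "T \<subseteq> {1..n}" and "equiv ({1..n} - T) R" and "i \<in> {1..n} - T"
  shows "(xv i :: 'k::field xypoly) \<notin> var_minor_ideal n T R"
proof -
  obtain \<beta> where R: "R = label_pairs n T \<beta>" using equiv_label[OF assms(2)] .
  have "toric_map n T \<beta> (xv i :: 'k xypoly) \<noteq> 0"
    using assms(3)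
    by (auto simp: single_one_neq_0 poly_var_def toric_monomial_def avoids_def lookup_single when_def single_times)
  then show ?thesis
    unfolding R var_minor_ideal_label_pairs[OF T] by simp
qed

text \<open>Modulo a prime in which \<open>x\<^sub>j\<close> and \<open>y\<^sub>j\<close> do not both vanish, these identities make the vanishing
  of minors a transitive relation.\<close>

lemma minor_trans:
  "xv j * minor i k = xv i * minor j k + xv k * minor i j"
  "yv j * minor i k = yv i * minor j k + yv k * minor i j"
  by (simp_all add: minor_def algebra_simps)

text \<open>The vertices whose two variables lie in \<open>p\<close> form \<open>T'\<close>; on the other vertices, membership of
  the minors in \<open>p\<close> is an equivalence relation. Intersecting it with \<open>E0\<close> keeps it an
  equivalence relation, and keeps the pairs within the blocks of \<open>E0\<close>.\<close>

lemma prime_contains_var_minor_prime: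
  fixes p :: "'k::field xypoly set"
  assumes p: "primeideal p (poly_ring n)" and T: "T \<subseteq> {1..n}" and E0: "equiv {1..n} E0" and E: "E \<subseteq> E0"
    and sub: "var_minor_ideal n T E \<subseteq> p"
  obtains T' E' where "T' \<subseteq> {1..n}" "E' \<subseteq> E0"
    "primeideal (var_minor_ideal n T' E' :: 'k xypoly set) (poly_ring n)"
    "var_minor_ideal n T E \<subseteq> (var_minor_ideal n T' E' :: 'k xypoly set)" "var_minor_ideal n T' E' \<subseteq> p"
proof
  interpret primeideal p "poly_ring n" by (rule p)
  have ideal_p: "ideal p (poly_ring n)" by (rule is_ideal)
  note P = poly_ideal_closed[OF ideal_p]
  have E0_sub: "E0 \<subseteq> {1..n} \<times> {1..n}"
    using E0 by (rule equiv_type)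
  define T' where "T' = {i \<in> {1..n}. xv i \<in> p \<and> yv i \<in> p}"
  define R where "R = {(i, j) \<in> E0. i \<notin> T' \<and> j \<notin> T' \<and> minor i j \<in> p}"
  show T': "T' \<subseteq> {1..n}" and "R \<subseteq> E0" by (auto simp: T'_def R_def)
  have R: "R \<subseteq> {1..n} \<times> {1..n}" using \<open>R \<subseteq> E0\<close> E0_sub by blast
  have "minor i k \<in> p" if "(i, j) \<in> R" "(j, k) \<in> R" for i j k
  proof -
    have mem: "i \<in> {1..n}" "j \<in> {1..n}" "k \<in> {1..n}" "j \<notin> T'" "minor i j \<in> p" "minor j k \<in> p"
      using that R by (auto simp: R_def)
    have "xv j * minor i k \<in> p" "yv j * minor i k \<in> p"
      unfolding minor_trans[of j i k] by (intro P(3,4) var_carrier mem)+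
    then show ?thesis
      using mem I_prime[of "xv j" "minor i k"] I_prime[of "yv j" "minor i k"]
      by (auto simp: T'_def var_carrier minor_carrier)
  qed
  then have "trans R"
    using E0 unfolding R_def equiv_def trans_def by blast
  moreover have "sym R"
  proof (rule symI)
    fix i j assume ij: "(i, j) \<in> R"
    then have "- minor i j \<in> p" using P(5) by (simp add: R_def)
    then have "minor j i \<in> p" by (simp add: minor_def)
    moreover have "(j, i) \<in> E0" using ij E0 by (auto simp: R_def equiv_def dest: symD)
    ultimately show "(j, i) \<in> R" using ij by (simp add: R_def)
  qed
  moreover have "refl_on ({1..n} - T') R"
    using E0 P(2) unfolding R_def equiv_def refl_on_def by (auto simp: minor_def)
  moreover have "R \<subseteq> ({1..n} - T') \<times> ({1..n} - T')"
    using R by (auto simp: R_def)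
  ultimately have "equiv ({1..n} - T') R" by (simp add: equiv_def)
  then show "primeideal (var_minor_ideal n T' R :: 'k xypoly set) (poly_ring n)"
    by (rule primeideal_var_minor_ideal[OF T'])
  show "var_minor_ideal n T' R \<subseteq> p"
    unfolding var_minor_ideal_subset_iff[OF T' R ideal_p] by (auto simp: T'_def R_def)
  have E_sub: "E \<subseteq> {1..n} \<times> {1..n}" using E E0_sub by blast
  have gens: "(\<forall>i\<in>T. xv i \<in> p \<and> yv i \<in> p) \<and> (\<forall>(i, j)\<in>E. minor i j \<in> p)"
    using sub var_minor_ideal_subset_iff[OF T E_sub ideal_p] by blast
  note ideal' = ideal_var_minor_ideal[OF T' R, where 'k = 'k]
  note mem' = var_minor_ideal_mem[OF T' R, where 'k = 'k]
  show "var_minor_ideal n T E \<subseteq> (var_minor_ideal n T' R :: 'k xypoly set)"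
    unfolding var_minor_ideal_subset_iff[OF T E_sub ideal']
  proof (intro conjI ballI; clarify?)
    fix i assume "i \<in> T"
    then have "i \<in> T'" using gens T by (auto simp: T'_def)
    then show "xv i \<in> (var_minor_ideal n T' R :: 'k xypoly set)"
      "yv i \<in> (var_minor_ideal n T' R :: 'k xypoly set)" by (fact mem')+
  next
    fix i j assume ij: "(i, j) \<in> E"
    then have "i \<in> {1..n}" "j \<in> {1..n}" using E_sub by auto
    then have "i \<in> T' \<or> j \<in> T' \<or> (i, j) \<in> R"
      using bspec[OF conjunct2[OF gens] ij] ij E by (auto simp: R_def)
    then show "minor i j \<in> (var_minor_ideal n T' R :: 'k xypoly set)"
      using mem'(3) minor_mem_of_vertex[OF T' R] \<open>i \<in> {1..n}\<close> \<open>j \<in> {1..n}\<close> by blast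
  qed
qed

section \<open>The ideals of the primary decomposition\<close>

lemma equiv_connected_rel: "equiv (gverts G) (connected_rel G)"
proof (rule equivI)
  let ?E = "{(a, b). {a, b} \<in> gedges G}"
  show "connected_rel G \<subseteq> gverts G \<times> gverts G" "refl_on (gverts G) (connected_rel G)"
    by (auto simp: connected_rel_def refl_on_def)
  have "sym (?E\<^sup>*)"
    by (rule sym_rtrancl) (auto simp: sym_def insert_commute)
  then show "sym (connected_rel G)"
    unfolding connected_rel_def sym_def by blast
  show "trans (connected_rel G)"
    unfolding connected_rel_def trans_def by (auto intro: rtrancl_trans)
qed

lemma connected_rel_delete_verts: "connected_rel (delete_verts G T) \<subseteq> connected_rel G"
proof -
  have "{(a, b). {a, b} \<in> gedges (delete_verts G T)} \<subseteq> {(a, b). {a, b} \<in> gedges G}"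
    by (auto simp: delete_verts_def)
  from rtrancl_mono[OF this] show ?thesis
    unfolding connected_rel_def by (auto simp: delete_verts_def)
qed

lemma connected_rel_iff_component:
  "(i, j) \<in> connected_rel G \<longleftrightarrow> (\<exists>C\<in>components G. i \<in> C \<and> j \<in> C)"
proof
  note R = equiv_connected_rel[of G]
  assume "(i, j) \<in> connected_rel G"
  moreover from this have "i \<in> gverts G" using equiv_type[OF R] by blast
  ultimately show "\<exists>C\<in>components G. i \<in> C \<and> j \<in> C"
    unfolding components_def using equiv_class_self[OF R] by (intro bexI[OF _ quotientI]) auto
next
  assume "\<exists>C\<in>components G. i \<in> C \<and> j \<in> C"
  then show "(i, j) \<in> connected_rel G"
    unfolding components_def using in_quotient_imp_in_rel[OF equiv_connected_rel] by blast
qed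

text \<open>The generators on the left are indexed by \<open>None\<close> for the variables and \<open>Some C\<close> for the
  component \<open>C\<close>. They comprise only the minors with \<open>i < j\<close>; the others are zero or
  differ by a sign.\<close>

lemma P_ideal_eq_var_minor_ideal:
  assumes V: "gverts G = {1..n}" and T: "T \<subseteq> {1..n}"
  shows "(P_ideal n G T :: 'k::field xypoly set)
      = var_minor_ideal n T (connected_rel (delete_verts G T))"
proof -
  let ?H = "delete_verts G T"
  let ?R = "connected_rel ?H"
  let ?B = "\<lambda>C. {xv i * yv j - xv j * yv i :: 'k xypoly | i j.
      {i, j} \<in> gedges (complete_graph C) \<and> 1 \<le> i \<and> i < j \<and> j \<le> n}"
  let ?gens = "\<lambda>D. case D of None \<Rightarrow> xv ` T \<union> yv ` T | Some C \<Rightarrow> ?B C"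
  let ?D = "insert None (Some ` components ?H)"
  have edge: "{i, j} \<in> gedges (complete_graph C) \<longleftrightarrow> i \<in> C \<and> j \<in> C \<and> i \<noteq> j" for i j C
    by (auto simp: complete_graph_def doubleton_eq_iff)
  have R: "?R \<subseteq> {1..n} \<times> {1..n}"
    using equiv_type[OF equiv_connected_rel[of ?H]] V by (auto simp: delete_verts_def)
  have carr: "?gens D \<subseteq> carrier (poly_ring n)" for D
    using T by (cases D)
      (auto intro!: var_carrier minor_carrier[unfolded minor_def])
  have "P_ideal n G T = Idl\<^bsub>poly_ring n\<^esub> (\<Union>D\<in>?D. Idl\<^bsub>poly_ring n\<^esub> (?gens D))"
    by (simp add: P_ideal_def ideal_Sum_def binomial_edge_ideal_def image_image)
  also have "\<dots> = Idl\<^bsub>poly_ring n\<^esub> (\<Union>D\<in>?D. ?gens D)"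
    by (rule poly.genideal_UN_genideal) (rule carr)
  also have "\<dots> = var_minor_ideal n T ?R"
  proof
    note J = ideal_var_minor_ideal[OF T R, where 'k = 'k]
    note mem = var_minor_ideal_mem[OF T R, where 'k = 'k]
    have "?gens D \<subseteq> var_minor_ideal n T ?R" if "D \<in> ?D" for D
    proof (cases D)
      case None
      then show ?thesis using mem(1,2) by auto
    next
      case (Some C)
      then have "C \<in> components ?H" using that by auto
      then have "(i, j) \<in> ?R" if "i \<in> C" "j \<in> C" for i j
        using that connected_rel_iff_component by blast
      then show ?thesis
        using mem(3) by (auto simp: Some edge minor_def)
    qed
    then show "Idl\<^bsub>poly_ring n\<^esub> (\<Union>D\<in>?D. ?gens D) \<subseteq> var_minor_ideal n T ?R"
      by (intro poly.genideal_minimal[OF J] UN_least)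
    define U :: "'k xypoly set" where "U = (\<Union>D\<in>?D. ?gens D)"
    have U: "U \<subseteq> carrier (poly_ring n)"
      unfolding U_def by (rule UN_least) (rule carr)
    have vars: "xv i \<in> U" "yv i \<in> U" if "i \<in> T" for i
      unfolding U_def by (rule UN_I[of None]; use that in simp)+
    have minors: "minor i j \<in> U" if ij: "(i, j) \<in> ?R" and "i < j" for i j
    proof -
      obtain C where C: "C \<in> components ?H" "i \<in> C" "j \<in> C"
        using ij connected_rel_iff_component by blast
      have "i \<in> {1..n}" "j \<in> {1..n}" using ij R by auto
      with C(2,3) have "minor i j \<in> ?B C"
        using \<open>i < j\<close> edge[of i j C] unfolding minor_def mem_Collect_eq
        by (intro exI[of _ i] exI[of _ j]) simp
      then show ?thesis
        unfolding U_def using C(1) by (intro UN_I[of "Some C"]) simp_all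
    qed
    note I = poly.genideal_ideal[OF U] and self = poly.genideal_self[OF U]
    note I_closed = poly_ideal_closed[OF I]
    have "minor i j \<in> Idl\<^bsub>poly_ring n\<^esub> U" if ij: "(i, j) \<in> ?R" for i j
    proof (cases i j rule: linorder_cases)
      case less
      then show ?thesis using minors ij self by blast
    next
      case equal
      then show ?thesis using I_closed(2) by (simp add: minor_def)
    next
      case greater
      have "(j, i) \<in> ?R"
        using ij equiv_connected_rel[of ?H] by (meson equiv_def symD)
      then have "minor j i \<in> Idl\<^bsub>poly_ring n\<^esub> U"
        using greater minors self by blast
      from I_closed(5)[OF this] show ?thesis by (simp add: minor_def)
    qed
    then have "var_minor_ideal n T ?R \<subseteq> Idl\<^bsub>poly_ring n\<^esub> U"
      using vars self unfolding var_minor_ideal_subset_iff[OF T R I] by blast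
    then show "var_minor_ideal n T ?R \<subseteq> Idl\<^bsub>poly_ring n\<^esub> (\<Union>D\<in>?D. ?gens D)"
      by (simp only: U_def)
  qed
  finally show ?thesis .
qed

section \<open>Adding the ideal of the connectedness relation\<close>

context
  fixes n :: nat and G :: graph
  assumes simple: "simple_graph G" and V: "gverts G = {1..n}"
begin

abbreviation E\<^sub>G :: "(nat \<times> nat) set" where "E\<^sub>G \<equiv> connected_rel G"

lemma equiv_EG: "equiv {1..n} E\<^sub>G"
  using equiv_connected_rel[of G] by (simp add: V)

lemma EG_subset: "E\<^sub>G \<subseteq> {1..n} \<times> {1..n}"
  using equiv_EG by (rule equiv_type)

lemma delete_no_verts: "delete_verts G {} = G"
  using simple by (auto simp: delete_verts_def simple_graph_def intro: prod_eqI)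

lemma P_ideal_empty: "(P_ideal n G {} :: 'k::field xypoly set) = var_minor_ideal n {} E\<^sub>G"
  using P_ideal_eq_var_minor_ideal[OF V, of "{}"] by (simp add: delete_no_verts)

text \<open>The pairs \<open>E\<close> are absorbed because they are already inside the components of \<open>G\<close>.\<close>

lemma add_P_ideal_empty:
  assumes T: "T \<subseteq> {1..n}" and E: "E \<subseteq> E\<^sub>G"
  shows "var_minor_ideal n T E <+>\<^bsub>poly_ring n\<^esub> P_ideal n G {}
      = (var_minor_ideal n T E\<^sub>G :: 'k::field xypoly set)"
proof -
  have E': "E \<subseteq> {1..n} \<times> {1..n}" using E EG_subset by blast
  note J1 = ideal_var_minor_ideal[OF T E', where 'k = 'k]
    and J2 = ideal_var_minor_ideal[OF empty_subsetI EG_subset, where 'k = 'k]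
    and J = ideal_var_minor_ideal[OF T EG_subset, where 'k = 'k]
  have carr: "var_minor_ideal n T E \<union> var_minor_ideal n {} E\<^sub>G \<subseteq> carrier (poly_ring n :: 'k xypoly ring)"
    using poly_ideal_closed(1)[OF J1] poly_ideal_closed(1)[OF J2] by simp
  note I = poly.genideal_ideal[OF carr] and self = poly.genideal_self[OF carr]
  have "Idl\<^bsub>poly_ring n\<^esub> (var_minor_ideal n T E \<union> var_minor_ideal n {} E\<^sub>G)
      = (var_minor_ideal n T E\<^sub>G :: 'k xypoly set)"
  proof
    show "Idl\<^bsub>poly_ring n\<^esub> (var_minor_ideal n T E \<union> var_minor_ideal n {} E\<^sub>G)
        \<subseteq> (var_minor_ideal n T E\<^sub>G :: 'k xypoly set)"
      using E var_minor_ideal_mem[OF T EG_subset, where 'k = 'k]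
      by (intro poly.genideal_minimal[OF J] Un_least)
        (auto simp: var_minor_ideal_subset_iff[OF T E' J]
          var_minor_ideal_subset_iff[OF empty_subsetI EG_subset J])
    show "(var_minor_ideal n T E\<^sub>G :: 'k xypoly set)
        \<subseteq> Idl\<^bsub>poly_ring n\<^esub> (var_minor_ideal n T E \<union> var_minor_ideal n {} E\<^sub>G)"
      using self var_minor_ideal_mem(1,2)[OF T E', where 'k = 'k]
        var_minor_ideal_mem(3)[OF empty_subsetI EG_subset, where 'k = 'k]
      unfolding var_minor_ideal_subset_iff[OF T EG_subset I] by blast
  qed
  then show ?thesis
    by (simp add: P_ideal_empty poly.union_genideal[OF J1 J2])
qed

abbreviation EG_ideals :: "'k::field xypoly set set" where
  "EG_ideals \<equiv> var_minor_ideals n E\<^sub>G"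

text \<open>A minimal prime contains a prime of the given shape over the same ideal, and so equals it.\<close>

lemma minimal_primes_EG_ideals:
  assumes "I \<in> EG_ideals"
  shows "minimal_primes (poly_ring n) I \<subseteq> (EG_ideals :: 'k::field xypoly set set)"
proof
  fix q assume q: "q \<in> minimal_primes (poly_ring n) I"
  obtain T E where I: "I = var_minor_ideal n T E" "T \<subseteq> {1..n}" "E \<subseteq> E\<^sub>G"
    using assms by (rule var_minor_idealsE)
  have prime_q: "primeideal q (poly_ring n)" "var_minor_ideal n T E \<subseteq> q"
    using q I(1) by (auto simp: minimal_primes_def)
  obtain T' E' where T'E': "T' \<subseteq> {1..n}" "E' \<subseteq> E\<^sub>G"
    and "primeideal (var_minor_ideal n T' E' :: 'k xypoly set) (poly_ring n)"
      "var_minor_ideal n T E \<subseteq> (var_minor_ideal n T' E' :: 'k xypoly set)"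
      "var_minor_ideal n T' E' \<subseteq> q"
    using prime_contains_var_minor_prime[OF prime_q(1) I(2) equiv_EG I(3) prime_q(2)] by metis
  then have "q = var_minor_ideal n T' E'"
    using q I(1) unfolding minimal_primes_def by blast
  then show "q \<in> EG_ideals" using T'E' by (simp only: var_minor_idealsI)
qed

lemma add_P_ideal_EG_ideals:
  assumes "I \<in> EG_ideals"
  shows "I <+>\<^bsub>poly_ring n\<^esub> P_ideal n G {} \<in> (EG_ideals :: 'k::field xypoly set set)"
  using assms by (rule var_minor_idealsE) (simp only: add_P_ideal_empty var_minor_idealsI order.refl)

lemma P_ideal_EG_ideals:
  assumes "T \<in> cut_sets G"
  shows "P_ideal n G T \<in> (EG_ideals :: 'k::field xypoly set set)"
proof -
  have "T \<subseteq> {1..n}" using assms V by (simp add: cut_sets_def)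
  then show ?thesis
    using connected_rel_delete_verts by (simp only: P_ideal_eq_var_minor_ideal[OF V] var_minor_idealsI)
qed

lemma Q_family_subset: "(Q_family n G :: 'k::field xypoly set set) \<subseteq> EG_ideals"
proof
  fix I :: "'k xypoly set" assume "I \<in> Q_family n G"
  then show "I \<in> EG_ideals"
  proof induction
    case (base I)
    then obtain A where A: "A \<subseteq> P_ideal n G ` cut_sets G" "I = ideal_Sum (poly_ring n) A"
      by (auto simp: P_sums_def ideal_sums_def)
    then show ?case
      unfolding A(2) using P_ideal_EG_ideals
      by (intro ideal_Sum_var_minor_ideals[OF _ EG_subset] order.trans[OF A(1)] image_subsetI)
  next
    case (step I J)
    then obtain A where A: "A \<subseteq> minimal_primes (poly_ring n) I \<union>
          (\<lambda>q. q <+>\<^bsub>poly_ring n\<^esub> P_ideal n G {}) ` minimal_primes (poly_ring n) I"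
        "J = ideal_Sum (poly_ring n) A"
      by (auto simp: ideal_sums_def)
    have M: "minimal_primes (poly_ring n) I \<subseteq> EG_ideals"
      by (rule minimal_primes_EG_ideals[OF step.IH])
    then have "A \<subseteq> EG_ideals"
      using A(1) add_P_ideal_EG_ideals by blast
    then show ?case
      unfolding A(2) by (rule ideal_Sum_var_minor_ideals[OF _ EG_subset])
  qed
qed

lemma empty_in_cut_sets: "{} \<in> cut_sets G"
  by (simp add: cut_sets_def)

lemma ideal_EG_ideals: "I \<in> EG_ideals \<Longrightarrow> ideal I (poly_ring n :: 'k::field xypoly ring)"
  by (erule var_minor_idealsE) (use ideal_var_minor_ideal EG_subset in \<open>metis order.trans\<close>)

lemma ideal_P_ideal_empty: "ideal (P_ideal n G {} :: 'k::field xypoly set) (poly_ring n)"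
  unfolding P_ideal_empty by (rule ideal_var_minor_ideal[OF _ EG_subset]) simp

lemma add_P_ideal_empty_idem:
  assumes "q \<in> EG_ideals"
  shows "(q <+>\<^bsub>poly_ring n\<^esub> P_ideal n G {}) <+>\<^bsub>poly_ring n\<^esub> P_ideal n G {}
      = q <+>\<^bsub>poly_ring n\<^esub> (P_ideal n G {} :: 'k::field xypoly set)"
  using assms by (rule var_minor_idealsE) (simp only: add_P_ideal_empty order.refl)

text \<open>The ideal \<open>P_ideal n G {}\<close> is itself among the ideals whose sums make up \<open>P_sums n G\<close>. At a
  later step, it can be added to each summand separately: a minimal prime \<open>r\<close> becomes the
  summand \<open>r + P_ideal n G {}\<close>, which is on offer, and a summand of the latter kind
  does not change.\<close>

lemma Q_family_add_P_ideal:
  assumes "q \<in> (Q_family n G :: 'k::field xypoly set set)"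
  shows "q <+>\<^bsub>poly_ring n\<^esub> P_ideal n G {} \<in> Q_family n G"
  using assms
proof cases
  case base
  then obtain A where A: "A \<subseteq> P_ideal n G ` cut_sets G" "A \<noteq> {}" "q = ideal_Sum (poly_ring n) A"
    by (auto simp: P_sums_def ideal_sums_def)
  have "ideal p (poly_ring n)" if "p \<in> A" for p
    using that A(1) P_ideal_EG_ideals ideal_EG_ideals by blast
  then have "q <+>\<^bsub>poly_ring n\<^esub> P_ideal n G {} = ideal_Sum (poly_ring n) (insert (P_ideal n G {}) A)"
    unfolding A(3) using poly.ideal_Sum_insert[OF _ ideal_P_ideal_empty] by metis
  moreover have "insert (P_ideal n G {}) A \<subseteq> P_ideal n G ` cut_sets G"
    using A(1) empty_in_cut_sets by blast
  ultimately show ?thesis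
    by (intro Q_family.base) (auto simp: P_sums_def ideal_sums_def)
next
  case (step I)
  let ?M = "minimal_primes (poly_ring n) I"
  let ?add = "\<lambda>q. q <+>\<^bsub>poly_ring n\<^esub> (P_ideal n G {} :: 'k xypoly set)"
  obtain A where A: "A \<subseteq> ?M \<union> ?add ` ?M" "A \<noteq> {}" "q = ideal_Sum (poly_ring n) A"
    using step(3) by (auto simp: ideal_sums_def)
  have M: "?M \<subseteq> EG_ideals"
    using minimal_primes_EG_ideals Q_family_subset step(1) by blast
  then have "A \<subseteq> EG_ideals"
    using A(1) add_P_ideal_EG_ideals by blast
  then have "ideal p (poly_ring n)" if "p \<in> A" for p
    using that ideal_EG_ideals by blast
  from poly.ideal_Sum_image_add[OF A(2) this ideal_P_ideal_empty]
  have "?add q = ideal_Sum (poly_ring n) (?add ` A)"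
    unfolding A(3) by simp
  moreover have "?add ` A \<subseteq> ?add ` ?M"
  proof (rule image_subsetI)
    fix p assume "p \<in> A"
    then consider "p \<in> ?M" | r where "r \<in> ?M" "p = ?add r" using A(1) by blast
    then show "?add p \<in> ?add ` ?M"
    proof cases
      case 2
      then have "?add p = ?add r" using M add_P_ideal_empty_idem by blast
      then show ?thesis using 2 by blast
    qed blast
  qed
  then have "?add ` A \<subseteq> ?M \<union> ?add ` ?M" "?add ` A \<noteq> {}"
    using A(2) by blast+
  ultimately have "?add q \<in> ideal_sums (poly_ring n) (?M \<union> ?add ` ?M)"
    unfolding ideal_sums_def by blast
  then show ?thesis by (rule Q_family.step[OF step(1,2)])
qed

lemma irrelevant_ideal_eq: "irrelevant_ideal n = (var_minor_ideal n {1..n} {} :: 'k::field xypoly set)"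
  by (simp add: irrelevant_ideal_def var_minor_ideal_def var_minor_gens_def)

text \<open>A minor involving a vertex of \<open>T\<close> lies in the ideal of the variables of that vertex, so only
  the pairs off \<open>T\<close> count, and they form an equivalence relation there.\<close>

lemma primeideal_EG:
  assumes T: "T \<subseteq> {1..n}"
  shows "primeideal (var_minor_ideal n T E\<^sub>G :: 'k::field xypoly set) (poly_ring n)" (is ?prime)
    and "i \<in> {1..n} - T \<Longrightarrow> (xv i :: 'k xypoly) \<notin> var_minor_ideal n T E\<^sub>G"
proof -
  let ?R = "E\<^sub>G \<inter> (- T) \<times> (- T)"
  have R: "?R \<subseteq> {1..n} \<times> {1..n}" using EG_subset by blast
  have "equiv ({1..n} - T) ?R"
  proof (rule equivI)
    show "?R \<subseteq> ({1..n} - T) \<times> ({1..n} - T)" using R by blast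
    show "refl_on ({1..n} - T) ?R"
      using equiv_EG by (auto simp: equiv_def refl_on_def)
    show "sym ?R" using equiv_EG unfolding equiv_def sym_def by blast
    show "trans ?R" using equiv_EG unfolding equiv_def trans_def by blast
  qed
  moreover have "var_minor_ideal n T E\<^sub>G = (var_minor_ideal n T ?R :: 'k xypoly set)"
  proof
    note J = ideal_var_minor_ideal[OF T EG_subset, where 'k = 'k]
      and J' = ideal_var_minor_ideal[OF T R, where 'k = 'k]
    show "var_minor_ideal n T E\<^sub>G \<subseteq> (var_minor_ideal n T ?R :: 'k xypoly set)"
      unfolding var_minor_ideal_subset_iff[OF T EG_subset J']
    proof (intro conjI ballI; clarify?)
      fix i j assume ij: "(i, j) \<in> E\<^sub>G"
      then have "i \<in> {1..n}" "j \<in> {1..n}" using EG_subset by blast+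
      moreover have "i \<in> T \<or> j \<in> T \<or> (i, j) \<in> ?R" using ij by blast
      ultimately show "minor i j \<in> (var_minor_ideal n T ?R :: 'k xypoly set)"
        using minor_mem_of_vertex[OF T R] var_minor_ideal_mem(3)[OF T R] by blast
    qed (simp_all add: var_minor_ideal_mem(1,2)[OF T R])
    show "(var_minor_ideal n T ?R :: 'k xypoly set) \<subseteq> var_minor_ideal n T E\<^sub>G"
      using var_minor_ideal_mem[OF T EG_subset, where 'k = 'k]
      unfolding var_minor_ideal_subset_iff[OF T R J] by blast
  qed
  ultimately show ?prime "i \<in> {1..n} - T \<Longrightarrow> (xv i :: 'k xypoly) \<notin> var_minor_ideal n T E\<^sub>G"
    using primeideal_var_minor_ideal[OF T] xvar_notin_var_minor_ideal[OF T] by auto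
qed

lemma EG_ideal_psubset_irrelevant:
  assumes T: "T \<subset> {1..n}"
  shows "var_minor_ideal n T E\<^sub>G \<subset> (irrelevant_ideal n :: 'k::field xypoly set)"
proof -
  have T': "T \<subseteq> {1..n}" using T by blast
  have E: "{} \<subseteq> {1..n} \<times> {1..n}" by blast
  note J = ideal_var_minor_ideal[OF order.refl E, where 'k = 'k]
    and mem = var_minor_ideal_mem[OF order.refl E, where 'k = 'k]
    and vert = minor_mem_of_vertex[OF order.refl E, where 'k = 'k]
  obtain i where "i \<in> {1..n} - T" using T by blast
  then have "xv i \<in> (irrelevant_ideal n :: 'k xypoly set)" "(xv i :: 'k xypoly) \<notin> var_minor_ideal n T E\<^sub>G"
    using mem(1) primeideal_EG(2)[OF T'] by (auto simp: irrelevant_ideal_eq)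
  moreover have "var_minor_ideal n T E\<^sub>G \<subseteq> (irrelevant_ideal n :: 'k xypoly set)"
    using mem vert T' EG_subset
    unfolding irrelevant_ideal_eq var_minor_ideal_subset_iff[OF T' EG_subset J] by blast
  ultimately show ?thesis by blast
qed

lemma P_ideal_empty_in_Q_family: "(P_ideal n G {} :: 'k::field xypoly set) \<in> Q_family n G"
proof -
  let ?R = "poly_ring n :: 'k xypoly ring"
  have "ideal_Sum ?R {P_ideal n G {}} = P_ideal n G {}"
    using poly.genideal_of_ideal[OF ideal_P_ideal_empty] by (simp add: ideal_Sum_def)
  moreover have "ideal_Sum ?R {P_ideal n G {}} \<in> P_sums n G"
    using empty_in_cut_sets unfolding P_sums_def ideal_sums_def by blast
  ultimately show ?thesis using Q_family.base by metis
qed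

lemma finite_EG_ideals: "finite EG_ideals"
proof -
  have "finite E\<^sub>G" by (rule finite_subset[OF EG_subset]) simp
  then show ?thesis by (simp add: var_minor_ideals_def)
qed

text \<open>The join of \<open>z\<close>, with vertex set \<open>T\<close>, and \<open>P_ideal n G {}\<close> is their sum. It stays below the
  irrelevant ideal because \<open>T\<close> omits a vertex \<open>i\<close>, and \<open>x\<^sub>i\<close> then is not in the sum.\<close>

lemma interval_joins:
  assumes z: "z \<in> Q_interval_top n G (irrelevant_ideal n :: 'k::field xypoly set)"
  shows "\<exists>j\<in>Q_interval_top n G (irrelevant_ideal n :: 'k xypoly set).
    z \<subseteq> j \<and> P_ideal n G {} \<subseteq> j \<and>
    (\<forall>w\<in>Q_interval_top n G (irrelevant_ideal n). z \<subseteq> w \<longrightarrow> P_ideal n G {} \<subseteq> w \<longrightarrow> j \<subseteq> w)"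
proof -
  have z': "z \<in> Q_family n G" "z \<subset> irrelevant_ideal n"
    using z by (auto simp: Q_interval_top_def Q_poset_def)
  then obtain T E where zTE: "z = var_minor_ideal n T E" and T: "T \<subseteq> {1..n}" and E: "E \<subseteq> E\<^sub>G"
    by (meson Q_family_subset subsetD var_minor_idealsE)
  have E': "E \<subseteq> {1..n} \<times> {1..n}" using E EG_subset by blast
  let ?j = "var_minor_ideal n T E\<^sub>G :: 'k xypoly set"
  note mem = var_minor_ideal_mem[OF T EG_subset, where 'k = 'k]
    and mem_z = var_minor_ideal_mem[OF T E', where 'k = 'k]
    and mem_P = var_minor_ideal_mem[OF empty_subsetI EG_subset, where 'k = 'k]
    and ideal_j = ideal_var_minor_ideal[OF T EG_subset, where 'k = 'k]
  have "T \<noteq> {1..n}"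
  proof
    assume "T = {1..n}"
    then have "irrelevant_ideal n \<subseteq> z"
      using mem_z ideal_var_minor_ideal[OF T E', where 'k = 'k]
      unfolding irrelevant_ideal_eq zTE
      by (subst var_minor_ideal_subset_iff) auto
    then show False using z'(2) by blast
  qed
  then have "?j \<subset> irrelevant_ideal n"
    using T EG_ideal_psubset_irrelevant by blast
  moreover have "?j \<in> Q_family n G"
    using Q_family_add_P_ideal[OF z'(1)] add_P_ideal_empty[OF T E, where 'k = 'k] zTE by metis
  ultimately have "?j \<in> Q_interval_top n G (irrelevant_ideal n)"
    using primeideal_EG(1)[OF T] by (simp add: Q_interval_top_def Q_poset_def)
  moreover have "z \<subseteq> ?j"
    using mem E unfolding zTE var_minor_ideal_subset_iff[OF T E' ideal_j] by blast
  moreover have "P_ideal n G {} \<subseteq> ?j"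
    using mem unfolding P_ideal_empty var_minor_ideal_subset_iff[OF empty_subsetI EG_subset ideal_j] by blast
  moreover have "?j \<subseteq> w" if w: "w \<in> Q_interval_top n G (irrelevant_ideal n)"
    and "z \<subseteq> w" "P_ideal n G {} \<subseteq> w" for w :: "'k xypoly set"
  proof -
    have "ideal w (poly_ring n)"
      using w Q_family_subset ideal_EG_ideals by (auto simp: Q_interval_top_def Q_poset_def)
    then show ?thesis
      using that(2,3) mem_z(1,2) mem_P(3) unfolding zTE P_ideal_empty
      by (subst var_minor_ideal_subset_iff[OF T EG_subset]) blast+
  qed
  ultimately show ?thesis
    by (intro bexI[of _ ?j] conjI ballI impI)
qed

end

theorem theorem4p4:
  fixes n :: nat and G :: graph
  assumes "1 \<le> n"
    and "simple_graph G"
    and "gverts G = {1..n}"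
    and "(irrelevant_ideal n :: 'k::field xypoly set) \<in> Q_poset n G"
  shows "contractible_poset (Q_interval_top n G (irrelevant_ideal n :: 'k xypoly set))
           (\<lambda>p q. q \<subset> p)"
proof (rule contractible_poset_joins[where c = "P_ideal n G {}"])
  note G = assms(2,3)
  let ?Q = "Q_interval_top n G (irrelevant_ideal n :: 'k xypoly set)"
  show "finite ?Q"
    by (rule finite_subset[OF _ finite_EG_ideals[OF G]])
      (use Q_family_subset[OF G] in \<open>auto simp: Q_interval_top_def Q_poset_def\<close>)
  have "{} \<subset> {1..n}" using assms(1) by auto
  then show "P_ideal n G {} \<in> ?Q"
    using P_ideal_empty_in_Q_family[OF G] primeideal_EG(1)[OF G, of "{}"]
      EG_ideal_psubset_irrelevant[OF G, of "{}"]
    by (simp add: Q_interval_top_def Q_poset_def P_ideal_empty[OF G])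
qed (rule interval_joins[OF assms(2,3)])

end
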